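(* Let $q>1$. Let $L\colon[a,b]\times\mathbb{R}^{2n}\to\mathbb{R}^d$, $(t,y,p)\mapsto L(t,y,p)$, be of class $C^1$ and suppose there are constants $K_1,K_2$ such that for every component $L_i$ and all $t\in[a,b]$, $y,p\in\mathbb{R}^n$, $$|L_i(t,y,p)|\le K_1(|y|^q+|p|^q+1),\quad |D_pL_i(t,y,p)|\le K_2(|y|^{q-1}+|p|^{q-1}+1),\quad |D_yL_i(t,y,p)|\le K_2(|y|^{q-1}+|p|^{q-1}+1).$$ Assume that every component of $G\colon\mathbb{R}^n\to\mathbb{R}^m$ satisfies $|\nabla G_i(w)|\le K(|w|^{q-1}+1)$ for some constant $K$. Let $M\subset\mathcal{X}_2$ be an infimizer for $\overline J$. Given $\zeta\in C^+\setminus\{0\}$, suppose that there exists $y_\zeta\in M$ such that $\varphi_{\zeta,M}(0)=J_\zeta(y_\zeta)$. Suppose that there exist $w_i\in W_0^{1,q}([a,b];\mathbb{R}^n)$, $1\le i\le m$, such that $$\det\left(\int_a^b\nabla G_i(y_\zeta)\cdot w_j\,dt\right)_{i,j=1,\dots,m}\ne0.$$ For every $v\in W_0^{1,q}([a,b];\mathbb{R}^n)$, let $w(s)=sv+\sum_{i=1}^m\sigma_i(s)w_i$, $s\in[0,\delta)$, be the associated curve, and let $\lambda=(\lambda_1,\dots,\lambda_m)$ be the associated multiplier (both defined in the context). Then $$\left.\frac{d}{ds}\widehat J_\zeta(w(s);M)\right|_{s=0}=S_{(\xi_\zeta,\zeta)}(v)=H^+(\zeta),$$ where $\xi_\zeta=D_yL_\zeta(t,y_\zeta,\dot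 y_\zeta)-\frac{d}{dt}D_pL_\zeta(t,y_\zeta,\dot y_\zeta)-\sum_{i=1}^m\lambda_i\nabla G_i(y_\zeta)$, understood in the weak sense as an element of the dual of $W_0^{1,q}([a,b];\mathbb{R}^n)$, i.e. $\xi_\zeta(v)=\int_a^b[D_yL_\zeta(t,y_\zeta,\dot y_\zeta)\cdot v+D_pL_\zeta(t,y_\zeta,\dot y_\zeta)\cdot\dot v]\,dt-\sum_{i=1}^m\lambda_i\int_a^b\nabla G_i(y_\zeta)\cdot v\,dt$.
   Context: Let $a<b$ be real, $n,m,d$ positive integers with $d>1$, $A,B\in\mathbb{R}^n$, and let $\emptyset\neq C\subsetneq\mathbb{R}^d$ be a closed convex cone with dual $C^+=\{\zeta\in\mathbb{R}^d\mid \zeta\cdot z\ge 0\ \forall z\in C\}$. Put $$\mathcal{X}_2=\Big\{y\in W^{1,q}([a,b];\mathbb{R}^n)\ \Big|\ y(a)=A,\ y(b)=B,\ \int_a^bG(y(t))\,dt=0\Big\},$$ $J(y)=\int_a^bL(t,y(t),\dot y(t))\,dt\in\mathbb{R}^d$, $\overline J(y)=J(y)+C$, $L_\zeta=\zeta\cdot L$, $J_\zeta(y)=\zeta\cdot J(y)$; $D_y,D_p$ denote gradients in $y$ and $p$. Infima of families of sets are taken in the complete lattice, ordered by $\supseteq$, of sets $D\subseteq\mathbb{R}^d$ with $D=\mathrm{cl}(D+C)$, so that $\inf\mathcal{A}=\mathrm{cl}\bigcup_{D\in\mathcal{A}}D$ (when convexity is assumed, $\overline J$ is instead regarded as taking values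 in the complete lattice of sets with $D=\mathrm{cl\,co}(D+C)$, where $\inf\mathcal{A}=\mathrm{cl\,co}\bigcup_{D\in\mathcal{A}}D$). A set $M\subseteq\mathcal{X}_2$ is an infimizer for $\overline J$ if $\inf_{y\in M}\overline J(y)=\inf_{y\in\mathcal{X}_2}\overline J(y)$. The inf-translation of $\overline J$ by $M$ is $\widehat J(v;M)=\inf_{y\in M}\overline J(y+v)$, $v\in W_0^{1,q}([a,b];\mathbb{R}^n)$, and $\varphi_{\zeta,M}\colon W_0^{1,q}([a,b];\mathbb{R}^n)\to\mathbb{R}\cup\{\pm\infty\}$ is $\varphi_{\zeta,M}(v)=\inf_{z\in\widehat J(v;M)}\zeta\cdot z=\inf_{y\in M}J_\zeta(y+v)$. The curve: let $W$ be the $m\times m$ matrix with entries $W_{ij}=\int_a^b\nabla G_i(y_\zeta)\cdot w_j\,dt$. Given $v$, let $h\colon\mathbb{R}\times\mathbb{R}^m\to\mathbb{R}^m$, $h(s,\sigma)=\int_a^bG\big(y_\zeta(t)+sv(t)+\sum_{i=1}^m\sigma_iw_i(t)\big)dt$. Then $h(0,0)=0$ and $\frac{\partial h}{\partial\sigma}(0,0)=W$ is invertible, and $\sigma\colon[0,\delta)\to\mathbb{R}^m$ is the map given by the implicit function theorem, with $\sigma(0)=0$, $h(s,\sigma(s))=0$ for all $s\in[0,\delta)$ and $\sigma'(0)=-W^{-1}\frac{\partial h}{\partial s}(0,0)$. Then $w(s)=sv+\sum_{i=1}^m\sigma_i(s)w_i$. The multiplier: $\lambda_j=\sum_{i=1}^m(W^{-1})_{ij}\int_a^b[D_yL_\zeta(t,y_\zeta,\dot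 y_\zeta)\cdot w_i+D_pL_\zeta(t,y_\zeta,\dot y_\zeta)\cdot\dot w_i]\,dt$, $j=1,\dots,m$. Set-valued notions: $H^+(\zeta)=\{z\in\mathbb{R}^d\mid\zeta\cdot z\ge0\}$; for $\xi$ in the dual of $W_0^{1,q}([a,b];\mathbb{R}^n)$, $S_{(\xi,\zeta)}(v)=\{z\in\mathbb{R}^d\mid\zeta\cdot z\ge\xi(v)\}$; $D-_\zeta E=\{z\in\mathbb{R}^d\mid z+E\subseteq\mathrm{cl}(D+H^+(\zeta))\}$, which can also be written $\{z\in\mathbb{R}^d\mid\zeta\cdot z+\inf_{e\in E}\zeta\cdot e\ge\inf_{x\in D}\zeta\cdot x\}$. The derivative of a set-valued function $f$ along a curve $\gamma$ with respect to $\zeta$ at $s_0$ is $\frac{d}{ds}f_\zeta(\gamma(s))\big|_{s=s_0}=\lim_{s\to s_0}\frac1{s-s_0}\big(f(\gamma(s))-_\zeta f(\gamma(s_0))\big)$; here $f=\widehat J(\cdot;M)$, $\gamma=w$ (defined on $[0,\delta)$), $s_0=0$. For a sequence of sets, $\lim_{k\to\infty}D_k=\{z\in\mathbb{R}^d\mid \forall k\ \exists z_k\in D_k,\ \lim_{k\to\infty}z_k=z\}$, and $\lim_{s\to s_0}D_s$ is the set which equals $\lim_{k\to\infty}D_{s_k}$ for every sequence $s_k\to s_0$ in the (one-sided) index interval.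
   Formalization: The objective is taken to be defined on the feasible set only and to equal the empty set (value +∞) outside it, so translates y+v violating the integral constraint do not contribute to the inf-translation; with J(y+v)+C for all translates the claim is false. *)

theory Defs
  imports "HOL-Analysis.Analysis"
begin

definition grad :: "('a::real_inner \<Rightarrow> real) \<Rightarrow> 'a \<Rightarrow> 'a" where
  "grad f x = (THE D. GDERIV f x :> D)"

text \<open>Class C^1 on a set that need not be open, such as {a..b} x R^n x R^n: the derivative is
  taken within the set.\<close>

definition C1_on :: "'a::real_normed_vector set \<Rightarrow> ('a \<Rightarrow> 'b::real_normed_vector) \<Rightarrow> bool" where
  "C1_on S f \<longleftrightarrow>
     (\<exists>f' :: 'a \<Rightarrow> 'a \<Rightarrow>\<^sub>L 'b.
        (\<forall>x\<in>S. (f has_derivative blinfun_apply (f' x)) (at x within S)) \<and> continuous_on S f')"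


section \<open>Sobolev spaces on an interval\<close>

definition Lq :: "real \<Rightarrow> real \<Rightarrow> real \<Rightarrow> (real \<Rightarrow> real^'n) set" where
  "Lq a b q = {g. g \<in> borel_measurable (lebesgue_on {a..b}) \<and>
                  integrable (lebesgue_on {a..b}) (\<lambda>t. norm (g t) powr q)}"

definition test_fun :: "real \<Rightarrow> real \<Rightarrow> (real \<Rightarrow> real) \<Rightarrow> bool" where
  "test_fun a b \<phi> \<longleftrightarrow>
     \<phi> C1_differentiable_on UNIV \<and> closure {t. \<phi> t \<noteq> 0} \<subseteq> {a<..<b}"

definition is_weak_deriv ::
    "real \<Rightarrow> real \<Rightarrow> (real \<Rightarrow> real^'n) \<Rightarrow> (real \<Rightarrow> real^'n) \<Rightarrow> bool" where
  "is_weak_deriv a b y g \<longleftrightarrow>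
     integrable (lebesgue_on {a..b}) y \<and> integrable (lebesgue_on {a..b}) g \<and>
     (\<forall>\<phi>. test_fun a b \<phi> \<longrightarrow>
        (LINT t|lebesgue_on {a..b}. deriv \<phi> t *\<^sub>R y t) =
          - (LINT t|lebesgue_on {a..b}. \<phi> t *\<^sub>R g t))"

text \<open>Determined almost everywhere on {a..b}; it only ever occurs under integrals.\<close>

definition weak_deriv :: "real \<Rightarrow> real \<Rightarrow> (real \<Rightarrow> real^'n) \<Rightarrow> real \<Rightarrow> real^'n" where
  "weak_deriv a b y = (SOME g. is_weak_deriv a b y g)"

text \<open>As usual for one independent variable, an element of W^{1,q} is identified with its continuous
  representative, so that boundary values make sense. Such a function is in L^q by continuity.
  Elements are total functions whose values outside {a..b} are irrelevant.\<close>

definition W1q :: "real \<Rightarrow> real \<Rightarrow> real \<Rightarrow> (real \<Rightarrow> real^'n) set" where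
  "W1q a b q = {y. continuous_on {a..b} y \<and> (\<exists>g \<in> Lq a b q. is_weak_deriv a b y g)}"

definition W1q0 :: "real \<Rightarrow> real \<Rightarrow> real \<Rightarrow> (real \<Rightarrow> real^'n) set" where
  "W1q0 a b q = {v \<in> W1q a b q. v a = 0 \<and> v b = 0}"


section \<open>Cones, infima and the isoperimetric problem\<close>

definition dual_cone :: "(real^'d) set \<Rightarrow> (real^'d) set" where
  "dual_cone C = {\<zeta>. \<forall>z\<in>C. 0 \<le> \<zeta> \<bullet> z}"

definition Hplus :: "real^'d \<Rightarrow> (real^'d) set" where
  "Hplus \<zeta> = {z. 0 \<le> \<zeta> \<bullet> z}"

text \<open>Infimum in the complete lattice, ordered by \<open>\<supseteq>\<close>, of the sets D = cl (D + C).
  The greatest element of this lattice is the empty set.\<close>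

definition lattice_inf :: "(real^'d) set set \<Rightarrow> (real^'d) set" where
  "lattice_inf \<A> = closure (\<Union>\<A>)"

definition X2 ::
    "real \<Rightarrow> real \<Rightarrow> real \<Rightarrow> real^'n \<Rightarrow> real^'n \<Rightarrow> (real^'n \<Rightarrow> real^'m) \<Rightarrow> (real \<Rightarrow> real^'n) set" where
  "X2 a b q A B G =
     {y \<in> W1q a b q. y a = A \<and> y b = B \<and> (LINT t|lebesgue_on {a..b}. G (y t)) = 0}"

definition J ::
    "real \<Rightarrow> real \<Rightarrow> (real \<Rightarrow> real^'n \<Rightarrow> real^'n \<Rightarrow> real^'d) \<Rightarrow> (real \<Rightarrow> real^'n) \<Rightarrow> real^'d" where
  "J a b L y = (LINT t|lebesgue_on {a..b}. L t (y t) (weak_deriv a b y t))"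

text \<open>The objective of the set optimization problem is a function on the feasible set X, here
  X = X2. It is extended by the greatest lattice element \<open>{}\<close> (the analogue of the value \<open>+\<infinity>\<close>)
  outside X. This matters for the inf-translation below: since X2 is not invariant under
  translations, y + v may be infeasible for some y in M, and those y must not contribute to the
  infimum.\<close>

definition Jbar ::
    "real \<Rightarrow> real \<Rightarrow> (real \<Rightarrow> real^'n) set \<Rightarrow> (real^'d) set \<Rightarrow>
     (real \<Rightarrow> real^'n \<Rightarrow> real^'n \<Rightarrow> real^'d) \<Rightarrow> (real \<Rightarrow> real^'n) \<Rightarrow> (real^'d) set" where
  "Jbar a b X C L y = (if y \<in> X then {J a b L y + c | c. c \<in> C} else {})"

definition infimizer ::
    "('x \<Rightarrow> (real^'d) set) \<Rightarrow> 'x set \<Rightarrow> 'x set \<Rightarrow> bool" where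
  "infimizer f X M \<longleftrightarrow> M \<subseteq> X \<and> lattice_inf (f ` M) = lattice_inf (f ` X)"

definition inf_translation ::
    "((real \<Rightarrow> real^'n) \<Rightarrow> (real^'d) set) \<Rightarrow> (real \<Rightarrow> real^'n) set \<Rightarrow>
     (real \<Rightarrow> real^'n) \<Rightarrow> (real^'d) set" where
  "inf_translation f M v = lattice_inf ((\<lambda>y. f (\<lambda>t. y t + v t)) ` M)"

definition scalarization :: "real^'d \<Rightarrow> ('x \<Rightarrow> (real^'d) set) \<Rightarrow> 'x \<Rightarrow> ereal" where
  "scalarization \<zeta> f v = (INF z\<in>f v. ereal (\<zeta> \<bullet> z))"


section \<open>Derivatives of set-valued functions along a curve\<close>

definition set_diff_zeta ::
    "(real^'d) set \<Rightarrow> real^'d \<Rightarrow> (real^'d) set \<Rightarrow> (real^'d) set" where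
  "set_diff_zeta D \<zeta> E =
     {z. {z + e | e. e \<in> E} \<subseteq> closure {x + h | x h. x \<in> D \<and> h \<in> Hplus \<zeta>}}"

definition set_seq_lim :: "(nat \<Rightarrow> (real^'d) set) \<Rightarrow> (real^'d) set" where
  "set_seq_lim D = {z. \<exists>x. (\<forall>k. x k \<in> D k) \<and> x \<longlonglongrightarrow> z}"

definition has_set_lim ::
    "(real \<Rightarrow> (real^'d) set) \<Rightarrow> (real^'d) set \<Rightarrow> real \<Rightarrow> real set \<Rightarrow> bool" where
  "has_set_lim D S s0 I \<longleftrightarrow>
     (\<forall>r. (\<forall>k. r k \<in> I - {s0}) \<and> r \<longlonglongrightarrow> s0 \<longrightarrow> set_seq_lim (\<lambda>k. D (r k)) = S)"

text \<open>The set S is the derivative of f along the curve \<open>\<gamma>\<close>, defined on I, with respect to \<open>\<zeta>\<close> at s0.\<close>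

definition has_set_deriv_along ::
    "real^'d \<Rightarrow> ('x \<Rightarrow> (real^'d) set) \<Rightarrow> (real \<Rightarrow> 'x) \<Rightarrow> (real^'d) set \<Rightarrow> real \<Rightarrow> real set \<Rightarrow> bool"
  where
  "has_set_deriv_along \<zeta> f \<gamma> S s0 I \<longleftrightarrow>
     has_set_lim
       (\<lambda>s. (\<lambda>z. (1 / (s - s0)) *\<^sub>R z) ` set_diff_zeta (f (\<gamma> s)) \<zeta> (f (\<gamma> s0))) S s0 I"

definition S_set :: "('x \<Rightarrow> real) \<Rightarrow> real^'d \<Rightarrow> 'x \<Rightarrow> (real^'d) set" where
  "S_set \<xi> \<zeta> v = {z. \<xi> v \<le> \<zeta> \<bullet> z}"


section \<open>The curve and the multiplier\<close>

definition gradG :: "(real^'n \<Rightarrow> real^'m) \<Rightarrow> 'm \<Rightarrow> real^'n \<Rightarrow> real^'n" where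
  "gradG G i x = grad (\<lambda>x. G x $ i) x"

definition Wmat ::
    "real \<Rightarrow> real \<Rightarrow> (real^'n \<Rightarrow> real^'m) \<Rightarrow> (real \<Rightarrow> real^'n) \<Rightarrow> ('m \<Rightarrow> real \<Rightarrow> real^'n) \<Rightarrow> real^'m^'m"
  where
  "Wmat a b G y w = (\<chi> i j. LINT t|lebesgue_on {a..b}. gradG G i (y t) \<bullet> w j t)"

definition hfun ::
    "real \<Rightarrow> real \<Rightarrow> (real^'n \<Rightarrow> real^'m) \<Rightarrow> (real \<Rightarrow> real^'n) \<Rightarrow> ('m \<Rightarrow> real \<Rightarrow> real^'n) \<Rightarrow>
     (real \<Rightarrow> real^'n) \<Rightarrow> real \<Rightarrow> real^'m \<Rightarrow> real^'m" where
  "hfun a b G y w v s \<sigma> =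
     (LINT t|lebesgue_on {a..b}. G (y t + s *\<^sub>R v t + (\<Sum>i\<in>UNIV. \<sigma> $ i *\<^sub>R w i t)))"

text \<open>The properties of the map \<open>\<sigma>\<close> on [0,\<open>\<delta>\<close>) provided by the implicit function theorem.\<close>

definition implicit_curve ::
    "real \<Rightarrow> real \<Rightarrow> (real^'n \<Rightarrow> real^'m) \<Rightarrow> (real \<Rightarrow> real^'n) \<Rightarrow> ('m \<Rightarrow> real \<Rightarrow> real^'n) \<Rightarrow>
     (real \<Rightarrow> real^'n) \<Rightarrow> real \<Rightarrow> (real \<Rightarrow> real^'m) \<Rightarrow> bool" where
  "implicit_curve a b G y w v \<delta> \<sigma> \<longleftrightarrow>
     0 < \<delta> \<and> \<sigma> 0 = 0 \<and>
     (\<forall>s\<in>{0..<\<delta>}. hfun a b G y w v s (\<sigma> s) = 0) \<and>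
     (\<sigma> has_vector_derivative
        - (matrix_inv (Wmat a b G y w) *v vector_derivative (\<lambda>s. hfun a b G y w v s 0) (at 0)))
       (at 0 within {0..<\<delta>})"

definition curve ::
    "('m::finite \<Rightarrow> real \<Rightarrow> real^'n) \<Rightarrow> (real \<Rightarrow> real^'n) \<Rightarrow> (real \<Rightarrow> real^'m) \<Rightarrow> real \<Rightarrow> real \<Rightarrow> real^'n"
  where
  "curve w v \<sigma> s = (\<lambda>t. s *\<^sub>R v t + (\<Sum>i\<in>UNIV. \<sigma> s $ i *\<^sub>R w i t))"

text \<open>The functional v \<open>\<mapsto>\<close> \<open>\<integral>\<close> (D_y L_zeta . v + D_p L_zeta . v') along y, i.e. the weak form of
  D_y L_zeta - d/dt D_p L_zeta.\<close>

definition EL ::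
    "real \<Rightarrow> real \<Rightarrow> (real \<Rightarrow> real^'n \<Rightarrow> real^'n \<Rightarrow> real^'d) \<Rightarrow> real^'d \<Rightarrow> (real \<Rightarrow> real^'n) \<Rightarrow>
     (real \<Rightarrow> real^'n) \<Rightarrow> real" where
  "EL a b L \<zeta> y v =
     (LINT t|lebesgue_on {a..b}.
        grad (\<lambda>x. \<zeta> \<bullet> L t x (weak_deriv a b y t)) (y t) \<bullet> v t +
        grad (\<lambda>p. \<zeta> \<bullet> L t (y t) p) (weak_deriv a b y t) \<bullet> weak_deriv a b v t)"

definition multiplier ::
    "real \<Rightarrow> real \<Rightarrow> (real \<Rightarrow> real^'n \<Rightarrow> real^'n \<Rightarrow> real^'d) \<Rightarrow> (real^'n \<Rightarrow> real^'m) \<Rightarrow> real^'d \<Rightarrow>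
     (real \<Rightarrow> real^'n) \<Rightarrow> ('m \<Rightarrow> real \<Rightarrow> real^'n) \<Rightarrow> real^'m" where
  "multiplier a b L G \<zeta> y w =
     (\<chi> j. \<Sum>i\<in>UNIV. matrix_inv (Wmat a b G y w) $ i $ j * EL a b L \<zeta> y (w i))"

definition xi ::
    "real \<Rightarrow> real \<Rightarrow> (real \<Rightarrow> real^'n \<Rightarrow> real^'n \<Rightarrow> real^'d) \<Rightarrow> (real^'n \<Rightarrow> real^'m) \<Rightarrow> real^'d \<Rightarrow>
     (real \<Rightarrow> real^'n) \<Rightarrow> real^'m \<Rightarrow> (real \<Rightarrow> real^'n) \<Rightarrow> real" where
  "xi a b L G \<zeta> y lam v =
     EL a b L \<zeta> y v -
     (\<Sum>i\<in>UNIV. lam $ i * (LINT t|lebesgue_on {a..b}. gradG G i (y t) \<bullet> v t))"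

end

theory Submission
  imports Defs
begin

text \<open>The integral constraint and the scalarized objective, restricted to the finite-dimensional
  family y + s v + \<open>\<Sum>\<close> \<open>\<sigma>\<close>_i w_i, are functions of (s, \<open>\<sigma>\<close>) that are differentiable at the origin, by
  dominated convergence and the growth conditions. Since 0 belongs to C and M is an infimizer,
  y_zeta minimizes J_zeta over all of X2, hence along every curve that stays in X2. The curve has
  derivative \<open>\<xi>\<close> v, and the one obtained by running s backwards has derivative \<open>- \<xi> v\<close>, so \<open>\<xi> v = 0\<close>.
  Finally, inf J_zeta over the translated family lies between J_zeta(y_zeta) and
  J_zeta(y_zeta + w(s)) = J_zeta(y_zeta) + o(s), which squeezes the difference quotients of sets
  to the half space H^+.\<close>

section \<open>Weak derivatives\<close>

text \<open>\<open>G\<close> is differentiable but its gradient need not be continuous, so the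
  classical implicit function theorem does not apply; a topological fixed point argument replaces
  it. It picks \<open>\<sigma> s\<close> separately for each s, possibly discontinuously away from
  0, which is harmless because only feasibility and the derivative at 0 are ever used. The curve
  lives on a one-sided interval, so minimality along it yields a single inequality for the
  functional; this is why existence of a curve matters beyond its place in the conclusion: the
  reversed branch has to be constructed too. The growth exponents fit together through (|x| +
  u)^(q-1) u \<le> (|x| + u)^q, whose right side is integrable along functions of W^{1,q}. A second
  obstacle is that \<open>weak_deriv\<close> is an arbitrary choice: the derivative chosen for a
  linear combination is not literally the combination of the chosen derivatives. Uniqueness almost
  everywhere, hence the fundamental lemma of the calculus of variations, is needed before the
  objective becomes an integral with a parameter.\<close>

text \<open>Squaring removes the kink of the positive part at 0, since
  \<open>(max 0 h)\<^sup>2 / h\<close> is at most |h| in size. As test functions are of class C^1,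
  such squares can serve as bumps.\<close>

lemma DERIV_max_0_square: "((\<lambda>x::real. (max 0 x)\<^sup>2) has_real_derivative 2 * max 0 x) (at x)"
proof -
  consider "x > 0" | "x < 0" | "x = 0" by linarith
  then show ?thesis
  proof cases
    case 1
    have "((\<lambda>x::real. x\<^sup>2) has_real_derivative 2 * x) (at x)"
      by (auto intro!: derivative_eq_intros)
    then have "((\<lambda>x::real. (max 0 x)\<^sup>2) has_real_derivative 2 * x) (at x)"
      by (rule has_field_derivative_transform_within_open[of _ _ _ "{0<..}"]) (use 1 in auto)
    then show ?thesis using 1 by simp
  next
    case 2
    have "((\<lambda>x::real. 0) has_real_derivative 0) (at x)"
      by (auto intro!: derivative_eq_intros)
    then have "((\<lambda>x::real. (max 0 x)\<^sup>2) has_real_derivative 0) (at x)"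
      by (rule has_field_derivative_transform_within_open[of _ _ _ "{..<0}"]) (use 2 in auto)
    then show ?thesis using 2 by simp
  next
    case 3
    have "((\<lambda>h::real. (max 0 h)\<^sup>2 / h) \<longlongrightarrow> 0) (at 0)"
    proof (rule Lim_null_comparison[of _ "\<lambda>h. \<bar>h\<bar>"])
      have "norm ((max 0 h)\<^sup>2 / h) \<le> \<bar>h\<bar>" for h :: real
        by (cases "h \<ge> 0") (auto simp: power2_eq_square)
      then show "\<forall>\<^sub>F h::real in at 0. norm ((max 0 h)\<^sup>2 / h) \<le> \<bar>h\<bar>"
        by (intro always_eventually allI)
      show "((\<lambda>h::real. \<bar>h\<bar>) \<longlongrightarrow> 0) (at 0)"
        by (rule tendsto_rabs_zero) (rule tendsto_ident_at)
    qed
    then show ?thesis using 3 by (simp add: DERIV_def)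
  qed
qed

text \<open>If u \<ge> 0 is C^1 and positive exactly on (c, d), then k u / (1 + k u) is C^1, lies in
  [0, 1), and tends to 1 where u > 0 while staying 0 elsewhere. The uniform bound 1 prepares
  dominated convergence.\<close>

lemma test_fun_approx_interval:
  fixes c d :: real
  assumes "a < c" "d < b"
  obtains \<phi> where "\<And>k. test_fun a b (\<phi> k)" "\<And>k t. \<bar>\<phi> k t\<bar> \<le> 1"
    "\<And>t. (\<lambda>k. \<phi> k t) \<longlonglongrightarrow> (if c < t \<and> t < d then 1 else 0)"
    "\<And>k. continuous_on UNIV (\<phi> k)"
proof
  \<comment> \<open>The case split matters: for d < c the product is positive between d and c,
    although the target indicator vanishes there.\<close>
  define p where "p t = (if c < d then max 0 ((t - c) * (d - t)) else 0)" for t :: real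
  define u where "u t = (p t)\<^sup>2" for t
  define u' where "u' t = 2 * p t * ((d - t) - (t - c))" for t
  define \<phi> where "\<phi> k t = real k * u t / (1 + real k * u t)" for k t
  have u0: "u t \<ge> 0" for t by (simp add: u_def)
  have pos: "1 + real k * u t > 0" for k t using u0[of t] by (simp add: add_pos_nonneg)
  have du: "(u has_real_derivative u' t) (at t)" for t
  proof (cases "c < d")
    case True
    have "((\<lambda>t. (t - c) * (d - t)) has_real_derivative ((d - t) - (t - c))) (at t)"
      by (auto intro!: derivative_eq_intros)
    from DERIV_chain2[OF DERIV_max_0_square this] show ?thesis
      using True unfolding u_def[abs_def] u'_def p_def by simp
  qed (simp add: u_def[abs_def] u'_def p_def)
  have cu: "continuous_on UNIV u" unfolding u_def p_def by (cases "c < d") (auto intro!: continuous_intros)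
  have cu': "continuous_on UNIV u'" unfolding u'_def p_def by (cases "c < d") (auto intro!: continuous_intros)
  show "continuous_on UNIV (\<phi> k)" for k
    unfolding \<phi>_def using cu pos[of k] by (intro continuous_intros) (auto simp: less_imp_neq[symmetric])
  have d\<phi>: "(\<phi> k has_real_derivative real k * u' t / (1 + real k * u t)\<^sup>2) (at t)" for k t
    unfolding \<phi>_def
  proof -
    have 1: "((\<lambda>t. real k * u t) has_real_derivative real k * u' t) (at t)"
      by (rule DERIV_cmult[OF du])
    have 2: "((\<lambda>t. 1 + real k * u t) has_real_derivative real k * u' t) (at t)"
      using DERIV_add[OF DERIV_const 1] by simp
    show "((\<lambda>t. real k * u t / (1 + real k * u t)) has_real_derivative
        real k * u' t / (1 + real k * u t)\<^sup>2) (at t)"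
      using DERIV_divide[OF 1 2] pos[of k t] by (simp add: algebra_simps power2_eq_square)
  qed
  have ppos: "p t > 0 \<longleftrightarrow> c < t \<and> t < d" for t
    by (auto simp: p_def zero_less_mult_iff less_max_iff_disj)
  have p0: "p t \<ge> 0" for t by (simp add: p_def)
  have upos: "u t \<noteq> 0 \<longleftrightarrow> c < t \<and> t < d" for t
    using ppos[of t] p0[of t] by (auto simp: u_def)
  show "test_fun a b (\<phi> k)" for k
  proof -
    have "{t. \<phi> k t \<noteq> 0} \<subseteq> {c..d}"
      using upos by (force simp: \<phi>_def)
    then have "closure {t. \<phi> k t \<noteq> 0} \<subseteq> {c..d}" by (simp add: closure_minimal)
    moreover have "\<phi> k C1_differentiable_on UNIV"
      unfolding C1_differentiable_on_def
    proof (intro exI conjI ballI)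
      show "(\<phi> k has_vector_derivative real k * u' t / (1 + real k * u t)\<^sup>2) (at t)" for t
        using d\<phi> by (simp add: has_real_derivative_iff_has_vector_derivative)
      show "continuous_on UNIV (\<lambda>t. real k * u' t / (1 + real k * u t)\<^sup>2)"
        using cu cu' pos[of k] by (intro continuous_intros) (auto simp: less_imp_neq[symmetric])
    qed
    ultimately show ?thesis using assms by (auto simp: test_fun_def)
  qed
  show "\<bar>\<phi> k t\<bar> \<le> 1" for k t
    using u0[of t] pos[of k t] by (simp add: \<phi>_def divide_le_eq)
  show "(\<lambda>k. \<phi> k t) \<longlonglongrightarrow> (if c < t \<and> t < d then 1 else 0)" for t
  proof (cases "u t = 0")
    case True then show ?thesis using upos[of t] by (auto simp: \<phi>_def)
  next
    case False
    then have "u t > 0" using u0[of t] by simp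
    have "filterlim (\<lambda>k. 1 + real k * u t) at_top sequentially"
      by (intro filterlim_tendsto_add_at_top[OF tendsto_const]
          filterlim_at_top_mult_tendsto_pos[OF tendsto_const \<open>u t > 0\<close>] filterlim_real_sequentially)
    then have "(\<lambda>k. 1 - inverse (1 + real k * u t)) \<longlonglongrightarrow> 1 - 0"
      by (intro tendsto_intros tendsto_inverse_0_at_top)
    moreover have "1 - inverse (1 + real k * u t) = \<phi> k t" for k
      using pos[of k t] by (simp add: \<phi>_def field_simps)
    ultimately show ?thesis using False upos[of t] by simp
  qed
qed

lemma integrable_bounded_continuous_scaleR:
  fixes g :: "real \<Rightarrow> 'e::euclidean_space"
  assumes g: "integrable (lebesgue_on {a..b}) g"
    and \<phi>: "continuous_on UNIV \<phi>" "\<And>t. \<bar>\<phi> t\<bar> \<le> B"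
  shows "integrable (lebesgue_on {a..b}) (\<lambda>t. \<phi> t *\<^sub>R g t)"
proof (rule Bochner_Integration.integrable_bound)
  show "integrable (lebesgue_on {a..b}) (\<lambda>t. B * norm (g t))" using g by simp
  have "\<phi> \<in> borel_measurable (lebesgue_on {a..b})"
    using \<phi>(1) by (intro continuous_imp_measurable_on_sets_lebesgue) (auto intro: continuous_on_subset)
  then show "(\<lambda>t. \<phi> t *\<^sub>R g t) \<in> borel_measurable (lebesgue_on {a..b})"
    using g by (intro borel_measurable_scaleR) auto
  show "AE t in lebesgue_on {a..b}. norm (\<phi> t *\<^sub>R g t) \<le> norm (B * norm (g t))"
    using \<phi>(2) by (intro AE_I2) (auto simp: abs_mult intro!: mult_right_mono intro: order_trans[OF _ abs_ge_self])
qed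

text \<open>Bumps converging to the indicator of (c, d) show that g has integral 0 over every [c, d]
  inside (a, b); Lebesgue differentiation then recovers g almost everywhere from these
  integrals.\<close>

lemma fundamental_lemma_calculus_of_variations:
  fixes g :: "real \<Rightarrow> 'e::euclidean_space"
  assumes g: "integrable (lebesgue_on {a..b}) g"
    and zero: "\<And>\<phi>. test_fun a b \<phi> \<Longrightarrow> (LINT t|lebesgue_on {a..b}. \<phi> t *\<^sub>R g t) = 0"
  shows "AE t in lebesgue_on {a..b}. g t = 0"
proof -
  \<comment> \<open>Extension by zero, because the differentiation theorem asks for integrability
    over every box.\<close>
  define f where "f t = (if t \<in> {a..b} then g t else 0)" for t
  have gi: "g integrable_on {a..b}"
    using g by (intro integrable_on_lebesgue_on) auto
  then have "f integrable_on UNIV"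
    unfolding f_def by (rule integrable_restrict_UNIV[THEN iffD2])
  then have fi: "f integrable_on cbox c d" for c d by (rule integrable_on_subcbox) simp
  have sub0: "integral {c..d} f = 0" if cd: "a < c" "d < b" for c d
  proof -
    obtain \<phi> where \<phi>: "\<And>k. test_fun a b (\<phi> k)" "\<And>k t. \<bar>\<phi> k t\<bar> \<le> (1::real)"
      "\<And>t. (\<lambda>k. \<phi> k t) \<longlonglongrightarrow> (if c < t \<and> t < d then 1 else 0)"
      "\<And>k. continuous_on UNIV (\<phi> k)"
      by (rule test_fun_approx_interval[OF cd]) (rule that)
    have 1: "\<And>k. (\<lambda>t. \<phi> k t *\<^sub>R g t) \<in> borel_measurable (lebesgue_on {a..b})"
      using integrable_bounded_continuous_scaleR[OF g \<phi>(4,2)] by (rule borel_measurable_integrable)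
    have 2: "(\<lambda>k. \<phi> k t *\<^sub>R g t) \<longlonglongrightarrow> (if c < t \<and> t < d then g t else 0)" for t
      using tendsto_scaleR[OF \<phi>(3) tendsto_const, of t "g t"] by (cases "c < t"; cases "t < d") simp_all
    have 3: "(\<lambda>t. if c < t \<and> t < d then g t else 0) \<in> borel_measurable (lebesgue_on {a..b})"
      by (rule borel_measurable_LIMSEQ_metric[OF 1 2])
    have bd: "AE t in lebesgue_on {a..b}. norm (\<phi> k t *\<^sub>R g t) \<le> norm (g t)" for k
      using \<phi>(2)[of k] by (intro AE_I2) (simp add: mult_left_le_one_le)
    have "(\<lambda>k. LINT t|lebesgue_on {a..b}. \<phi> k t *\<^sub>R g t) \<longlonglongrightarrow>
       (LINT t|lebesgue_on {a..b}. (if c < t \<and> t < d then g t else 0))"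
      using g by (intro integral_dominated_convergence[OF 3 1 _ _ bd]) (simp_all add: 2)
    then have L0: "(LINT t|lebesgue_on {a..b}. (if c < t \<and> t < d then g t else 0)) = 0"
      using zero[OF \<phi>(1)] by (simp add: LIMSEQ_const_iff)
    have "integrable (lebesgue_on {a..b}) (\<lambda>t. if c < t \<and> t < d then g t else 0)"
      using g 3 by (rule Bochner_Integration.integrable_bound) simp
    then have int0: "integral {a..b} (\<lambda>t. if c < t \<and> t < d then g t else 0) = 0"
      using L0 lebesgue_integral_eq_integral[of "{a..b}" "\<lambda>t. if c < t \<and> t < d then g t else 0"] by simp
    have "integral {c..d} f = integral {c<..<d} f"
      using integral_open_interval[of c d f] by simp
    also have "\<dots> = integral UNIV (\<lambda>t. if t \<in> {c<..<d} then f t else 0)"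
      by (rule integral_restrict_UNIV[symmetric])
    also have "(\<lambda>t. if t \<in> {c<..<d} then f t else 0) =
        (\<lambda>t. if t \<in> {a..b} then (if c < t \<and> t < d then g t else 0) else 0)"
      using cd by (intro ext) (simp add: f_def)
    also have "integral UNIV \<dots> = integral {a..b} (\<lambda>t. if c < t \<and> t < d then g t else 0)"
      by (rule integral_restrict_UNIV)
    also have "\<dots> = 0" by (rule int0)
    finally show ?thesis .
  qed
  obtain N where N: "negligible N"
     "\<And>x e. \<lbrakk>x \<notin> N; 0 < e\<rbrakk> \<Longrightarrow> \<exists>d>0. \<forall>h. 0 < h \<and> h < d \<longrightarrow>
         norm (integral (cbox x (x + h *\<^sub>R One)) f /\<^sub>R h ^ DIM(real) - f x) < e"
    by (rule integrable_ccontinuous_explicit[OF fi]) (rule that)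
  have g0: "g x = 0" if x: "x \<in> {a<..<b}" "x \<notin> N" for x
  proof (rule ccontr)
    assume "g x \<noteq> 0"
    then obtain d where d: "d > 0" "\<And>h. 0 < h \<Longrightarrow> h < d \<Longrightarrow>
         norm (integral (cbox x (x + h *\<^sub>R One)) f /\<^sub>R h ^ DIM(real) - f x) < norm (g x)"
    proof -
      have "f x = g x" using x by (simp add: f_def)
      then show thesis using N(2)[OF x(2), of "norm (g x)"] \<open>g x \<noteq> 0\<close> that by auto
    qed
    \<comment> \<open>Small enough for the averaging estimate and for [x, x + h] to stay inside (a,
      b), where the mean value of \<open>f\<close> is 0; the estimate would then read |g x| < |g
      x|.\<close>
    define h where "h = min (d/2) ((b - x)/2)"
    have h: "0 < h" "h < d" "x + h < b" using d(1) x by (auto simp: h_def min_def field_simps)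
    have "integral {x..x+h} f = 0" using sub0[of x "x+h"] x h by auto
    then show False using d(2)[OF h(1,2)] x by (simp add: f_def)
  qed
  have "negligible (insert a (insert b N))" using N(1) by simp
  then have "AE x in lebesgue. x \<notin> insert a (insert b N)"
    unfolding negligible_iff_null_sets by (rule AE_not_in)
  then have "AE x in lebesgue. x \<in> {a..b} \<longrightarrow> g x = 0"
  proof (rule eventually_mono)
    show "x \<in> {a..b} \<longrightarrow> g x = 0" if "x \<notin> insert a (insert b N)" for x
      using g0[of x] that by auto
  qed
  then show ?thesis by (simp add: AE_restrict_space_iff)
qed

text \<open>Compact support turns the bounds on {a..b} into global ones: outside this interval the
  function is 0 on an open set, so its derivative vanishes as well. Bounded continuous factors keep
  products with integrable functions integrable, which splitting integrals of sums requires.\<close>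

lemma test_fun_bounds:
  assumes "test_fun a b \<phi>"
  obtains B where "continuous_on UNIV \<phi>" "continuous_on UNIV (deriv \<phi>)"
    "\<And>t. \<bar>\<phi> t\<bar> \<le> B" "\<And>t. \<bar>deriv \<phi> t\<bar> \<le> B"
proof -
  obtain D where D: "\<And>t. (\<phi> has_vector_derivative D t) (at t)" "continuous_on UNIV D"
    using assms by (auto simp: test_fun_def C1_differentiable_on_def)
  then have dD: "deriv \<phi> = D"
    by (intro ext DERIV_imp_deriv) (simp add: has_real_derivative_iff_has_vector_derivative)
  have c\<phi>: "continuous_on UNIV \<phi>"
    using has_vector_derivative_continuous[OF D(1)] by (simp add: continuous_on_eq_continuous_at)
  have sub: "{t. \<phi> t \<noteq> 0} \<subseteq> {a<..<b}"
    using assms closure_subset[of "{t. \<phi> t \<noteq> 0}"] unfolding test_fun_def by (blast intro: order_trans)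
  have D0: "D t = 0" if "t \<notin> {a..b}" for t
  proof -
    have "open (- {a..b})" by (intro open_Compl closed_atLeastAtMost)
    then have "(\<phi> has_vector_derivative 0) (at t)"
      using that sub
      by (intro has_vector_derivative_transform_within_open[of "\<lambda>_. 0" 0 t "- {a..b}" \<phi>]) auto
    from vector_derivative_at[OF this] vector_derivative_at[OF D(1)[of t]] show ?thesis by simp
  qed
  have "bounded (\<phi> ` {a..b})" "bounded (D ` {a..b})"
    using c\<phi> D(2) by (auto intro!: compact_imp_bounded compact_continuous_image intro: continuous_on_subset)
  then obtain B1 B2 where B: "\<forall>t\<in>{a..b}. \<bar>\<phi> t\<bar> \<le> B1" "\<forall>t\<in>{a..b}. \<bar>D t\<bar> \<le> B2"
    unfolding bounded_iff by (auto simp del: atLeastAtMost_iff)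
  have "\<bar>\<phi> t\<bar> \<le> max 0 (max B1 B2)" for t
    using bspec[OF B(1), of t] sub by (cases "t \<in> {a..b}"; cases "\<phi> t = 0") auto
  moreover have "\<bar>D t\<bar> \<le> max 0 (max B1 B2)" for t
    using bspec[OF B(2), of t] D0[of t] by (cases "t \<in> {a..b}") auto
  ultimately show ?thesis
    by (intro that[of "max 0 (max B1 B2)"] c\<phi>) (simp_all add: dD D(2))
qed

section \<open>Uniqueness and linearity of weak derivatives\<close>

text \<open>Both candidates have the same integrals against test functions, so their difference
  falls under the fundamental lemma. This makes the choice in \<open>weak_deriv\<close> harmless
  under integrals.\<close>

lemma is_weak_deriv_unique:
  assumes "is_weak_deriv a b y g" "is_weak_deriv a b y g'"
  shows "AE t in lebesgue_on {a..b}. g t = g' t"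
proof -
  have g: "integrable (lebesgue_on {a..b}) g" "integrable (lebesgue_on {a..b}) g'"
    using assms by (auto simp: is_weak_deriv_def)
  have "AE t in lebesgue_on {a..b}. g t - g' t = 0"
  proof (rule fundamental_lemma_calculus_of_variations)
    show "integrable (lebesgue_on {a..b}) (\<lambda>t. g t - g' t)" using g by simp
    fix \<phi> assume \<phi>: "test_fun a b \<phi>"
    obtain B where B: "continuous_on UNIV \<phi>" "continuous_on UNIV (deriv \<phi>)"
        "\<And>t. \<bar>\<phi> t\<bar> \<le> B" "\<And>t. \<bar>deriv \<phi> t\<bar> \<le> B"
      by (rule test_fun_bounds[OF \<phi>]) (rule that)
    have "(LINT t|lebesgue_on {a..b}. \<phi> t *\<^sub>R g t) = (LINT t|lebesgue_on {a..b}. \<phi> t *\<^sub>R g' t)"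
    proof -
      have "- (LINT t|lebesgue_on {a..b}. \<phi> t *\<^sub>R g t) = - (LINT t|lebesgue_on {a..b}. \<phi> t *\<^sub>R g' t)"
        using assms \<phi> unfolding is_weak_deriv_def by auto
      then show ?thesis by simp
    qed
    then show "(LINT t|lebesgue_on {a..b}. \<phi> t *\<^sub>R (g t - g' t)) = 0"
      using g integrable_bounded_continuous_scaleR[OF g(1) B(1,3)] integrable_bounded_continuous_scaleR[OF g(2) B(1,3)]
      by (simp add: scaleR_diff_right)
  qed
  then show ?thesis by simp
qed

lemma is_weak_deriv_add:
  assumes "is_weak_deriv a b y g" "is_weak_deriv a b y' g'"
  shows "is_weak_deriv a b (\<lambda>t. y t + y' t) (\<lambda>t. g t + g' t)"
proof -
  have i: "integrable (lebesgue_on {a..b}) y" "integrable (lebesgue_on {a..b}) y'"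
     "integrable (lebesgue_on {a..b}) g" "integrable (lebesgue_on {a..b}) g'"
    using assms by (auto simp: is_weak_deriv_def)
  have "(LINT t|lebesgue_on {a..b}. deriv \<phi> t *\<^sub>R (y t + y' t)) =
          - (LINT t|lebesgue_on {a..b}. \<phi> t *\<^sub>R (g t + g' t))" if \<phi>: "test_fun a b \<phi>" for \<phi>
  proof -
    obtain B where B: "continuous_on UNIV \<phi>" "continuous_on UNIV (deriv \<phi>)"
        "\<And>t. \<bar>\<phi> t\<bar> \<le> B" "\<And>t. \<bar>deriv \<phi> t\<bar> \<le> B"
      by (rule test_fun_bounds[OF \<phi>]) (rule that)
    note I = integrable_bounded_continuous_scaleR[OF _ B(1) B(3)]
      integrable_bounded_continuous_scaleR[OF _ B(2) B(4)]
    have "(LINT t|lebesgue_on {a..b}. deriv \<phi> t *\<^sub>R y t) = - (LINT t|lebesgue_on {a..b}. \<phi> t *\<^sub>R g t)"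
      "(LINT t|lebesgue_on {a..b}. deriv \<phi> t *\<^sub>R y' t) = - (LINT t|lebesgue_on {a..b}. \<phi> t *\<^sub>R g' t)"
      using assms \<phi> unfolding is_weak_deriv_def by auto
    then show ?thesis
      by (simp add: scaleR_add_right I i)
  qed
  then show ?thesis using i by (simp add: is_weak_deriv_def)
qed

lemma is_weak_deriv_scaleR:
  assumes "is_weak_deriv a b y g"
  shows "is_weak_deriv a b (\<lambda>t. c *\<^sub>R y t) (\<lambda>t. c *\<^sub>R g t)"
proof -
  have *: "(LINT t|M. f t *\<^sub>R c *\<^sub>R h t) = c *\<^sub>R (LINT t|M. f t *\<^sub>R h t)"
    for M and f :: "real \<Rightarrow> real" and h :: "real \<Rightarrow> real^'n"
    by (simp only: scaleR_left_commute[of _ c] integral_scaleR_right)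
  show ?thesis
    using assms unfolding is_weak_deriv_def by (simp only: *) simp
qed

section \<open>The vector space structure of L^q and W^{1,q}\<close>

lemma powr_add_le:
  fixes x y q :: real
  assumes "0 \<le> x" "0 \<le> y" "0 \<le> q"
  shows "(x + y) powr q \<le> 2 powr q * (x powr q + y powr q)"
proof -
  have "(x + y) powr q \<le> (2 * max x y) powr q"
    using assms by (intro powr_mono2) auto
  also have "\<dots> = 2 powr q * (max x y) powr q"
    using assms by (simp add: powr_mult)
  also have "\<dots> \<le> 2 powr q * (x powr q + y powr q)"
    by (intro mult_left_mono) (auto simp: max_def)
  finally show ?thesis .
qed

lemma Lq_add:
  assumes "g \<in> Lq a b q" "g' \<in> Lq a b q" "0 \<le> q"
  shows "(\<lambda>t. g t + g' t) \<in> Lq a b q"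
proof -
  have [measurable]: "g \<in> borel_measurable (lebesgue_on {a..b})" "g' \<in> borel_measurable (lebesgue_on {a..b})"
    using assms by (auto simp: Lq_def)
  have "integrable (lebesgue_on {a..b}) (\<lambda>t. norm (g t + g' t) powr q)"
  proof (rule Bochner_Integration.integrable_bound)
    show "integrable (lebesgue_on {a..b}) (\<lambda>t. 2 powr q * (norm (g t) powr q + norm (g' t) powr q))"
      using assms by (auto simp: Lq_def)
    show "AE t in lebesgue_on {a..b}. norm (norm (g t + g' t) powr q)
            \<le> norm (2 powr q * (norm (g t) powr q + norm (g' t) powr q))"
    proof (rule AE_I2)
      fix t
      have "norm (g t + g' t) powr q \<le> (norm (g t) + norm (g' t)) powr q"
        using assms by (intro powr_mono2 norm_triangle_ineq) auto
      also have "\<dots> \<le> 2 powr q * (norm (g t) powr q + norm (g' t) powr q)"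
        using assms by (intro powr_add_le) auto
      finally show "norm (norm (g t + g' t) powr q)
            \<le> norm (2 powr q * (norm (g t) powr q + norm (g' t) powr q))" by simp
    qed
  qed measurable
  then show ?thesis by (simp add: Lq_def)
qed

lemma Lq_scaleR: "g \<in> Lq a b q \<Longrightarrow> (\<lambda>t. c *\<^sub>R g t) \<in> Lq a b q"
  by (auto simp: Lq_def powr_mult)

text \<open>The choice operator guarantees a weak derivative, but not one in L^q. Membership in L^q
  is carried over from the witness in the definition of \<open>W1q\<close>, with which the chosen
  function agrees almost everywhere.\<close>

lemma W1q_weak_deriv:
  assumes "y \<in> W1q a b q"
  shows "is_weak_deriv a b y (weak_deriv a b y)" "weak_deriv a b y \<in> Lq a b q"
proof -
  obtain g where g: "g \<in> Lq a b q" "is_weak_deriv a b y g" using assms by (auto simp: W1q_def)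
  show wd: "is_weak_deriv a b y (weak_deriv a b y)"
    unfolding weak_deriv_def using someI[of "is_weak_deriv a b y", OF g(2)] .
  then have m: "weak_deriv a b y \<in> borel_measurable (lebesgue_on {a..b})"
    by (auto simp: is_weak_deriv_def)
  have "AE t in lebesgue_on {a..b}. g t = weak_deriv a b y t"
    using is_weak_deriv_unique[OF g(2) wd] .
  then have "integrable (lebesgue_on {a..b}) (\<lambda>t. norm (weak_deriv a b y t) powr q)"
    using g(1) m unfolding Lq_def
    by (elim CollectE conjE, subst integrable_cong_AE[of _ _ "\<lambda>t. norm (g t) powr q"]) auto
  with m show "weak_deriv a b y \<in> Lq a b q" by (simp add: Lq_def)
qed

lemma W1q_add:
  assumes "y \<in> W1q a b q" "y' \<in> W1q a b q" "0 \<le> q"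
  shows "(\<lambda>t. y t + y' t) \<in> W1q a b q"
  using assms is_weak_deriv_add[OF W1q_weak_deriv(1)[OF assms(1)] W1q_weak_deriv(1)[OF assms(2)]]
    Lq_add[OF W1q_weak_deriv(2)[OF assms(1)] W1q_weak_deriv(2)[OF assms(2)] assms(3)]
  unfolding W1q_def by (auto intro: continuous_on_add)

lemma W1q_scaleR:
  assumes "y \<in> W1q a b q"
  shows "(\<lambda>t. c *\<^sub>R y t) \<in> W1q a b q"
  using assms is_weak_deriv_scaleR[OF W1q_weak_deriv(1)[OF assms]] Lq_scaleR[OF W1q_weak_deriv(2)[OF assms]]
  unfolding W1q_def by (auto intro: continuous_on_scaleR continuous_on_const)

lemma is_weak_deriv_zero: "is_weak_deriv a b (\<lambda>t. 0) (\<lambda>t. 0)"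
  by (simp add: is_weak_deriv_def)

lemma W1q_zero: "(\<lambda>t. 0) \<in> W1q a b q"
proof -
  have "(\<lambda>t. 0) \<in> Lq a b q" by (simp add: Lq_def)
  then show ?thesis using is_weak_deriv_zero unfolding W1q_def by fastforce
qed

lemma W1q_sum:
  assumes "finite I" "\<And>i. i \<in> I \<Longrightarrow> y i \<in> W1q a b q" "0 \<le> q"
  shows "(\<lambda>t. \<Sum>i\<in>I. y i t) \<in> W1q a b q"
  using assms by (induction I rule: finite_induct) (auto intro!: W1q_zero W1q_add)

lemma is_weak_deriv_sum:
  assumes "finite I" "\<And>i. i \<in> I \<Longrightarrow> is_weak_deriv a b (y i) (g i)"
  shows "is_weak_deriv a b (\<lambda>t. \<Sum>i\<in>I. y i t) (\<lambda>t. \<Sum>i\<in>I. g i t)"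
  using assms by (induction I rule: finite_induct) (auto intro!: is_weak_deriv_zero is_weak_deriv_add)

section \<open>Analytic tools\<close>

lemma tendsto_at_imp_LIMSEQ:
  fixes f :: "'a::metric_space \<Rightarrow> 'b::metric_space"
  assumes "(f \<longlongrightarrow> l) (at a within S)" "X \<longlonglongrightarrow> a" "\<And>i. X i \<in> S - {a}"
  shows "(\<lambda>k. f (X k)) \<longlonglongrightarrow> l"
proof -
  have "filterlim X (at a within S) sequentially"
    using assms(2,3) by (simp add: filterlim_at always_eventually)
  then show ?thesis by (rule filterlim_compose[OF assms(1)])
qed

text \<open>Presents a directional derivative as the limit of a sequence of difference quotients, so
  that measurability in an outside parameter passes to the derivative.\<close>

lemma has_derivative_imp_directional_LIMSEQ:
  fixes f :: "'c::real_normed_vector \<Rightarrow> 'f::real_normed_vector"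
  assumes "(f has_derivative D) (at 0)"
  shows "(\<lambda>k. real (Suc k) *\<^sub>R (f (inverse (real (Suc k)) *\<^sub>R c) - f 0)) \<longlonglongrightarrow> D c"
proof -
  interpret D: bounded_linear D using assms by (rule has_derivative_bounded_linear)
  have "((\<lambda>s::real. s *\<^sub>R c) has_derivative (\<lambda>s. s *\<^sub>R c)) (at 0)"
    by (auto intro!: derivative_eq_intros)
  from has_derivative_compose[OF this, of f D] assms
  have "((\<lambda>s. f (s *\<^sub>R c)) has_derivative (\<lambda>s. s *\<^sub>R D c)) (at 0)"
    by (simp add: D.scaleR)
  then have "((\<lambda>s. norm (f (s *\<^sub>R c) - f 0 - s *\<^sub>R D c) / norm s) \<longlongrightarrow> 0) (at 0)"
    by (simp add: has_derivative_at)
  moreover have "(\<lambda>k. inverse (real (Suc k))) \<longlonglongrightarrow> 0" by (rule LIMSEQ_inverse_real_of_nat)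
  ultimately have "(\<lambda>k. norm (f (inverse (real (Suc k)) *\<^sub>R c) - f 0 - inverse (real (Suc k)) *\<^sub>R D c)
      / norm (inverse (real (Suc k)))) \<longlonglongrightarrow> 0"
    by (rule tendsto_at_imp_LIMSEQ) simp
  moreover have "norm (f (inverse (real (Suc k)) *\<^sub>R c) - f 0 - inverse (real (Suc k)) *\<^sub>R D c)
      / norm (inverse (real (Suc k)))
    = norm (real (Suc k) *\<^sub>R (f (inverse (real (Suc k)) *\<^sub>R c) - f 0) - D c)" for k
  proof -
    have "real (Suc k) *\<^sub>R (f (inverse (real (Suc k)) *\<^sub>R c) - f 0) - D c
      = real (Suc k) *\<^sub>R (f (inverse (real (Suc k)) *\<^sub>R c) - f 0 - inverse (real (Suc k)) *\<^sub>R D c)"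
      by (simp add: scaleR_diff_right del: of_nat_Suc)
    then show ?thesis by (simp add: divide_inverse mult.commute del: of_nat_Suc)
  qed
  ultimately have "(\<lambda>k. norm (real (Suc k) *\<^sub>R (f (inverse (real (Suc k)) *\<^sub>R c) - f 0) - D c)) \<longlonglongrightarrow> 0"
    by (simp only:)
  then show ?thesis by (simp only: tendsto_norm_zero_iff Lim_null[symmetric])
qed

section \<open>Differentiation under the integral sign\<close>

lemma integrable_powr_add:
  fixes f g :: "'s \<Rightarrow> real"
  assumes "f \<in> borel_measurable M" "g \<in> borel_measurable M" "\<And>t. 0 \<le> f t" "\<And>t. 0 \<le> g t" "0 \<le> q"
    and "integrable M (\<lambda>t. f t powr q)" "integrable M (\<lambda>t. g t powr q)"
  shows "integrable M (\<lambda>t. (f t + g t) powr q)"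
proof (rule Bochner_Integration.integrable_bound)
  show "integrable M (\<lambda>t. 2 powr q * (f t powr q + g t powr q))"
    using assms by auto
  show "(\<lambda>t. (f t + g t) powr q) \<in> borel_measurable M"
    using assms by measurable
  show "AE t in M. norm ((f t + g t) powr q) \<le> norm (2 powr q * (f t powr q + g t powr q))"
    using powr_add_le[of "f _" "g _" q] assms by (intro AE_I2) simp
qed

lemma integrable_powr_sum:
  fixes f :: "'i \<Rightarrow> 's \<Rightarrow> real"
  assumes "finite I" "\<And>i. i \<in> I \<Longrightarrow> f i \<in> borel_measurable M" "\<And>i t. 0 \<le> f i t" "0 \<le> q"
    and "\<And>i. i \<in> I \<Longrightarrow> integrable M (\<lambda>t. f i t powr q)"
  shows "integrable M (\<lambda>t. (\<Sum>i\<in>I. f i t) powr q)"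
  using assms
proof (induction I rule: finite_induct)
  case (insert i I)
  have "integrable M (\<lambda>t. (f i t + (\<Sum>i\<in>I. f i t)) powr q)"
    using insert by (intro integrable_powr_add) (auto intro!: sum_nonneg)
  then show ?case using insert by simp
qed simp

text \<open>Here \<open>x0\<close> is the base curve, \<open>U t\<close> sends a parameter to the
  perturbation at t, and \<open>u\<close> bounds the norm of \<open>U t\<close>. The mean value
  inequality bounds the increments by an integrable function times |c|, so dominated convergence
  applies to the normalized remainder. Constraint and objective are both instances.\<close>

lemma has_derivative_integral_growth:
  fixes F :: "'s \<Rightarrow> 'e::real_normed_vector \<Rightarrow> 'f::euclidean_space"
    and U :: "'s \<Rightarrow> 'c::real_normed_vector \<Rightarrow> 'e"
  assumes fin: "finite_measure M" and q: "1 \<le> q"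
    and meas: "\<And>c. (\<lambda>t. F t (x0 t + U t c)) \<in> borel_measurable M"
    and int0: "integrable M (\<lambda>t. F t (x0 t))"
    and x0: "(\<lambda>t. norm (x0 t)) \<in> borel_measurable M" "integrable M (\<lambda>t. norm (x0 t) powr q)"
    and u: "u \<in> borel_measurable M" "\<And>t. 0 \<le> u t" "integrable M (\<lambda>t. u t powr q)"
    and U: "\<And>t. t \<in> space M \<Longrightarrow> bounded_linear (U t)"
      "\<And>t c. t \<in> space M \<Longrightarrow> norm (U t c) \<le> u t * norm c"
    and dF: "\<And>t x. t \<in> space M \<Longrightarrow> (F t has_derivative F' t x) (at x)"
    and bd: "\<And>t x h. t \<in> space M \<Longrightarrow> norm (F' t x h) \<le> K * (norm x powr (q - 1) + 1) * norm h"
  shows "\<And>c. integrable M (\<lambda>t. F' t (x0 t) (U t c))"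
    and "((\<lambda>c. LINT t|M. F t (x0 t + U t c)) has_derivative (\<lambda>c. LINT t|M. F' t (x0 t) (U t c))) (at 0)"
proof -
  interpret finite_measure M by (rule fin)
  \<comment> \<open>The growth bound for F' on the ball of radius |x0 t| + u t, multiplied by the
    size u t of a perturbation with |c| \<le> 1. It controls the increment (\<open>A\<close>) and
    the linear part (\<open>B\<close>) alike.\<close>
  define g where "g t = \<bar>K\<bar> * ((norm (x0 t) + u t) powr (q - 1) + 1) * u t" for t
  have g0: "g t \<ge> 0" for t using u by (simp add: g_def)
  have bdK: "norm (F' t x h) \<le> (\<bar>K\<bar> * ((norm (x0 t) + u t) powr (q - 1) + 1)) * norm h"
    if "t \<in> space M" "norm x \<le> norm (x0 t) + u t" for t x h
  proof -
    have "norm (F' t x h) \<le> K * (norm x powr (q - 1) + 1) * norm h" by (rule bd[OF that(1)])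
    also have "\<dots> \<le> \<bar>K\<bar> * (norm x powr (q - 1) + 1) * norm h"
      by (intro mult_right_mono) auto
    also have "\<dots> \<le> \<bar>K\<bar> * ((norm (x0 t) + u t) powr (q - 1) + 1) * norm h"
      using that q by (intro mult_right_mono mult_left_mono add_right_mono powr_mono2) auto
    finally show ?thesis .
  qed
  have A: "norm (F t (x0 t + U t c) - F t (x0 t)) \<le> g t * norm c" if t: "t \<in> space M" and c: "norm c \<le> 1" for t c
  proof -
    let ?B = "\<bar>K\<bar> * ((norm (x0 t) + u t) powr (q - 1) + 1)"
    have Uc: "norm (U t c) \<le> u t"
      using U(2)[OF t, of c] mult_left_mono[OF c u(2)[of t]] by simp
    have "norm (F t (x0 t + U t c) - F t (x0 t)) \<le> norm (U t c) * ?B"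
    proof (rule differentiable_bound_segment[where G=UNIV])
      show "(F t has_derivative F' t x) (at x within UNIV)" for x using dF[OF t] by simp
      fix s :: real assume s: "s \<in> {0..1}"
      have "norm (s *\<^sub>R U t c) \<le> u t"
        using s Uc mult_left_le_one_le[of "norm (U t c)" s] by simp
      then have "norm (x0 t + s *\<^sub>R U t c) \<le> norm (x0 t) + u t"
        using norm_triangle_ineq[of "x0 t" "s *\<^sub>R U t c"] by linarith
      then show "onorm (F' t (x0 t + s *\<^sub>R U t c)) \<le> ?B"
        using bdK[OF t] by (intro onorm_bound) auto
    qed simp
    also have "\<dots> \<le> (u t * norm c) * ?B"
      using U(2)[OF t, of c] by (intro mult_right_mono) auto
    finally show ?thesis by (simp add: g_def mult_ac)
  qed
  have B: "norm (F' t (x0 t) (U t c)) \<le> g t * norm c" if t: "t \<in> space M" for t c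
  proof -
    have "norm (F' t (x0 t) (U t c)) \<le> (\<bar>K\<bar> * ((norm (x0 t) + u t) powr (q - 1) + 1)) * norm (U t c)"
      using bdK[OF t, of "x0 t"] u(2)[of t] by simp
    also have "\<dots> \<le> (\<bar>K\<bar> * ((norm (x0 t) + u t) powr (q - 1) + 1)) * (u t * norm c)"
      using U(2)[OF t, of c] by (intro mult_left_mono) auto
    finally show ?thesis by (simp add: g_def mult_ac)
  qed
  have gi: "integrable M g"
  proof (rule Bochner_Integration.integrable_bound)
    have "integrable M (\<lambda>t. (norm (x0 t) + u t) powr q)"
      using x0 u q by (intro integrable_powr_add) auto
    then show "integrable M (\<lambda>t. \<bar>K\<bar> * ((norm (x0 t) + u t) powr q + (u t powr q + 1)))"
      using u by auto
    show "g \<in> borel_measurable M" unfolding g_def using x0(1) u(1) by measurable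
    \<comment> \<open>This replaces Hoelder's inequality: u is itself one summand of |x0| + u, so
      the factor u can be absorbed into the power.\<close>
    have 1: "x powr (q - 1) * y \<le> x powr q" if "0 \<le> y" "y \<le> x" for x y :: real
    proof (cases "x = 0")
      case False
      have "x powr (q - 1) * y \<le> x powr (q - 1) * x powr 1"
        using that False by (intro mult_left_mono) auto
      also have "\<dots> = x powr q" by (subst powr_add[symmetric]) simp
      finally show ?thesis .
    qed simp
    have 2: "y \<le> y powr q + 1" if "0 \<le> y" for y :: real
    proof (cases "y \<le> 1")
      case True then show ?thesis by (simp add: add_increasing)
    next
      case False then show ?thesis using powr_mono[of 1 q y] q by simp
    qed
    have "g t \<le> \<bar>K\<bar> * ((norm (x0 t) + u t) powr q + (u t powr q + 1))" for t
      using 1[of "u t" "norm (x0 t) + u t"] 2[of "u t"] u(2)[of t]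
      unfolding g_def mult.assoc by (intro mult_left_mono) (simp_all add: distrib_right)
    then show "AE t in M. norm (g t) \<le> norm (\<bar>K\<bar> * ((norm (x0 t) + u t) powr q + (u t powr q + 1)))"
      using g0 by (intro AE_I2) (simp add: abs_mult)
  qed
  have U0: "U t 0 = 0" if "t \<in> space M" for t
    using U(1)[OF that] by (simp add: linear_simps)
  have dpt: "((\<lambda>c. F t (x0 t + U t c)) has_derivative (\<lambda>c. F' t (x0 t) (U t c))) (at 0)" if t: "t \<in> space M" for t
  proof -
    have "((\<lambda>c. x0 t + U t c) has_derivative U t) (at 0)"
      using has_derivative_add[OF has_derivative_const bounded_linear_imp_has_derivative[OF U(1)[OF t]]]
      by simp
    from has_derivative_compose[OF this dF[OF t]] show ?thesis using U0[OF t] by simp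
  qed
  have meas0: "(\<lambda>t. F t (x0 t)) \<in> borel_measurable M" using int0 by simp
  \<comment> \<open>No measurability of F' is assumed; it is inherited from the difference quotients
    of F in the direction c.\<close>
  have m': "(\<lambda>t. F' t (x0 t) (U t c)) \<in> borel_measurable M" for c
  proof (rule borel_measurable_LIMSEQ_metric)
    show "(\<lambda>t. real (Suc k) *\<^sub>R (F t (x0 t + U t (inverse (real (Suc k)) *\<^sub>R c)) - F t (x0 t))) \<in> borel_measurable M" for k
      using meas meas0 by (intro borel_measurable_scaleR borel_measurable_diff) auto
    show "(\<lambda>k. real (Suc k) *\<^sub>R (F t (x0 t + U t (inverse (real (Suc k)) *\<^sub>R c)) - F t (x0 t))) \<longlonglongrightarrow> F' t (x0 t) (U t c)"
      if "t \<in> space M" for t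
      using has_derivative_imp_directional_LIMSEQ[OF dpt[OF that], of c] U0[OF that] by simp
  qed
  show i': "integrable M (\<lambda>t. F' t (x0 t) (U t c))" for c
  proof (rule Bochner_Integration.integrable_bound)
    show "integrable M (\<lambda>t. g t * norm c)" using gi by simp
    show "AE t in M. norm (F' t (x0 t) (U t c)) \<le> norm (g t * norm c)"
      using B g0 by (intro AE_I2) simp
  qed (rule m')
  have ic: "integrable M (\<lambda>t. F t (x0 t + U t c))" if c: "norm c \<le> 1" for c
  proof -
    have "integrable M (\<lambda>t. F t (x0 t + U t c) - F t (x0 t))"
    proof (rule Bochner_Integration.integrable_bound)
      show "integrable M (\<lambda>t. g t * norm c)" using gi by simp
      show "AE t in M. norm (F t (x0 t + U t c) - F t (x0 t)) \<le> norm (g t * norm c)"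
        using A[OF _ c] g0 by (intro AE_I2) simp
      show "(\<lambda>t. F t (x0 t + U t c) - F t (x0 t)) \<in> borel_measurable M"
        using meas meas0 by (intro borel_measurable_diff) auto
    qed
    from Bochner_Integration.integrable_add[OF this int0] show ?thesis by simp
  qed
  have lin: "F' t (x0 t) (U t (r *\<^sub>R c + c')) = r *\<^sub>R F' t (x0 t) (U t c) + F' t (x0 t) (U t c')"
    if "t \<in> space M" for t r c c'
    using linear_add[OF has_derivative_linear[OF dpt[OF that]], of "r *\<^sub>R c" c']
      linear_scale[OF has_derivative_linear[OF dpt[OF that]], of r c] by simp
  have blin: "bounded_linear (\<lambda>c. LINT t|M. F' t (x0 t) (U t c))"
  proof (rule bounded_linear_intro)
    fix r c c'
    have "(LINT t|M. F' t (x0 t) (U t (c + c'))) = (LINT t|M. F' t (x0 t) (U t c) + F' t (x0 t) (U t c'))"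
      by (rule Bochner_Integration.integral_cong[OF refl]) (use lin[of _ 1 c c'] in simp)
    then show "(LINT t|M. F' t (x0 t) (U t (c + c'))) = (LINT t|M. F' t (x0 t) (U t c)) + (LINT t|M. F' t (x0 t) (U t c'))"
      using i' by simp
    have "F' t (x0 t) (U t 0) = 0" if "t \<in> space M" for t
      using has_derivative_linear[OF dpt[OF that]] by (rule linear_0)
    then have "(LINT t|M. F' t (x0 t) (U t (r *\<^sub>R c))) = (LINT t|M. r *\<^sub>R F' t (x0 t) (U t c))"
      by (intro Bochner_Integration.integral_cong[OF refl]) (use lin[of _ r c 0] in simp)
    then show "(LINT t|M. F' t (x0 t) (U t (r *\<^sub>R c))) = r *\<^sub>R (LINT t|M. F' t (x0 t) (U t c))"
      by simp
    have "norm (LINT t|M. F' t (x0 t) (U t c)) \<le> (LINT t|M. g t * norm c)"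
      proof -
      have "norm (LINT t|M. F' t (x0 t) (U t c)) \<le> (LINT t|M. norm (F' t (x0 t) (U t c)))"
        by (rule integral_norm_bound)
      also have "\<dots> \<le> (LINT t|M. g t * norm c)"
        using i' gi B by (intro integral_mono) auto
      finally show ?thesis .
    qed
    then show "norm (LINT t|M. F' t (x0 t) (U t c)) \<le> norm c * (LINT t|M. g t)"
      by (simp add: mult.commute)
  qed
  let ?H = "\<lambda>c. LINT t|M. F t (x0 t + U t c)" and ?D = "\<lambda>c. LINT t|M. F' t (x0 t) (U t c)"
  have H0: "?H 0 = (LINT t|M. F t (x0 t))"
    by (rule Bochner_Integration.integral_cong[OF refl]) (simp add: U0)
  \<comment> \<open>Dominated convergence is a statement about sequences, so the limit is tested
    along arbitrary sequences. Their tails are taken so that |c| \<le> 1, the range in which the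
    increment bound holds.\<close>
  have "((\<lambda>h. norm (?H h - ?H 0 - ?D h) / norm h) \<longlongrightarrow> 0) (at 0)"
    unfolding tendsto_at_iff_sequentially
  proof (intro allI impI)
    fix X :: "nat \<Rightarrow> 'c" assume X: "\<forall>i. X i \<in> UNIV - {0}" "X \<longlonglongrightarrow> 0"
    from X(2) have "eventually (\<lambda>k. norm (X k) < 1) sequentially"
      unfolding tendsto_iff by simp
    then obtain N where "\<forall>k\<ge>N. norm (X k) < 1"
      unfolding eventually_sequentially by blast
    then have N: "norm (X (k + N)) < 1" for k by simp
    define Y where "Y k = X (k + N)" for k
    have Y: "Y k \<noteq> 0" "norm (Y k) \<le> 1" for k using X(1) N[of k] by (auto simp: Y_def)
    have Ylim: "Y \<longlonglongrightarrow> 0" unfolding Y_def using X(2) by (rule LIMSEQ_ignore_initial_segment)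
    define R where "R k t = norm (F t (x0 t + U t (Y k)) - F t (x0 t) - F' t (x0 t) (U t (Y k))) / norm (Y k)" for k t
    have Rm: "R k \<in> borel_measurable M" for k
      unfolding R_def using meas meas0 m'
      by (intro borel_measurable_divide borel_measurable_norm borel_measurable_diff) auto
    have Rbd: "norm (R k t) \<le> 2 * g t" if t: "t \<in> space M" for k t
    proof -
      have "norm (F t (x0 t + U t (Y k)) - F t (x0 t) - F' t (x0 t) (U t (Y k))) \<le> 2 * g t * norm (Y k)"
        using A[OF t Y(2), of k] B[OF t, of "Y k"] norm_triangle_ineq4[of "F t (x0 t + U t (Y k)) - F t (x0 t)" "F' t (x0 t) (U t (Y k))"]
        by linarith
      then show ?thesis using Y(1)[of k] by (simp add: R_def divide_le_eq)
    qed
    have Rlim: "(\<lambda>k. R k t) \<longlonglongrightarrow> 0" if t: "t \<in> space M" for t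
    proof -
      have "((\<lambda>h. norm (F t (x0 t + U t h) - F t (x0 t) - F' t (x0 t) (U t h)) / norm h) \<longlongrightarrow> 0) (at 0)"
        using dpt[OF t] U0[OF t] by (simp add: has_derivative_at)
      then show ?thesis unfolding R_def by (rule tendsto_at_imp_LIMSEQ[OF _ Ylim]) (simp add: Y(1))
    qed
    have Ri: "integrable M (R k)" for k
    proof (rule Bochner_Integration.integrable_bound[OF _ Rm])
      show "integrable M (\<lambda>t. 2 * g t)" using gi by simp
      show "AE t in M. norm (R k t) \<le> norm (2 * g t)"
        using Rbd[of _ k] g0 by (intro AE_I2) simp
    qed
    have "(\<lambda>k. LINT t|M. R k t) \<longlonglongrightarrow> (LINT t|M. 0)"
    proof (rule integral_dominated_convergence[where w="\<lambda>t. 2 * g t"])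
      show "AE t in M. (\<lambda>k. R k t) \<longlonglongrightarrow> 0" using Rlim by (rule AE_I2)
      show "AE t in M. norm (R k t) \<le> 2 * g t" for k using Rbd by (rule AE_I2)
    qed (use gi Rm in simp_all)
    then have L: "(\<lambda>k. LINT t|M. R k t) \<longlonglongrightarrow> 0" by simp
    have le: "norm (?H (Y k) - ?H 0 - ?D (Y k)) / norm (Y k) \<le> (LINT t|M. R k t)" for k
    proof -
      have "?H (Y k) - ?H 0 - ?D (Y k) = (LINT t|M. F t (x0 t + U t (Y k)) - F t (x0 t) - F' t (x0 t) (U t (Y k)))"
        unfolding H0 using ic[OF Y(2)] int0 i' by simp
      also have "norm \<dots> \<le> (LINT t|M. norm (F t (x0 t + U t (Y k)) - F t (x0 t) - F' t (x0 t) (U t (Y k))))"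
        by (rule integral_norm_bound)
      finally show ?thesis using Y(1)[of k] by (simp add: R_def divide_right_mono)
    qed
    have "(\<lambda>k. norm (?H (Y k) - ?H 0 - ?D (Y k)) / norm (Y k)) \<longlonglongrightarrow> 0"
      using le by (intro tendsto_sandwich[OF _ _ tendsto_const L]) auto
    then show "((\<lambda>h. norm (?H h - ?H 0 - ?D h) / norm h) \<circ> X) \<longlonglongrightarrow> 0"
      unfolding Y_def o_def by (rule LIMSEQ_offset)
  qed
  then show "(?H has_derivative ?D) (at 0)"
    using blin by (simp add: has_derivative_at)
qed

text \<open>A zero of \<open>x \<mapsto> H (s, x)\<close> near s p is a fixed point of \<open>x \<mapsto> x - T (H (s, x))\<close>, which Brouwer's
  theorem supplies since H need only be differentiable at the origin.\<close>

lemma implicit_curve_Brouwer: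
  fixes H :: "real \<times> 'e::euclidean_space \<Rightarrow> 'e"
  assumes cont: "\<And>s. continuous_on UNIV (\<lambda>x. H (s, x))"
    and H0: "H 0 = 0" and der: "(H has_derivative D) (at 0)"
    and T: "bounded_linear T" "\<And>x. T (D (0, x)) = x" "\<And>x. T x = 0 \<Longrightarrow> x = 0"
  obtains \<delta> \<sigma> where "0 < \<delta>" "\<sigma> 0 = 0" "\<And>s. s \<in> {0..<\<delta>} \<Longrightarrow> H (s, \<sigma> s) = 0"
    "(\<sigma> has_vector_derivative - T (D (1, 0))) (at 0 within {0..<\<delta>})"
proof -
  interpret T: bounded_linear T by (rule T)
  interpret D: bounded_linear D using der by (rule has_derivative_bounded_linear)
  define p where "p = - T (D (1, 0))"
  obtain B where B: "B > 0" "\<And>x. norm (T x) \<le> norm x * B" using T.pos_bounded by auto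
  \<comment> \<open>On the ball of radius s about s p, the map x - T (H (s, x)) takes values within
    e s of s p. With e = 1 it maps this ball into itself; with arbitrary e the estimate becomes
    differentiability of its fixed points at 0.\<close>
  have small: "\<exists>d>0. \<forall>s x. 0 \<le> s \<and> s < d \<and> x \<in> cball (s *\<^sub>R p) s \<longrightarrow> norm (x - T (H (s, x)) - s *\<^sub>R p) \<le> e * s"
    if e: "e > 0" for e
  proof -
    \<comment> \<open>On that ball |(s, x)| \<le> s (2 + |p|), and \<open>T\<close> costs another
      factor \<open>B\<close>; this choice makes the total error exactly e s.\<close>
    define e' where "e' = e / (B * (2 + norm p))"
    have np: "2 + norm p > 0" by (simp add: add_pos_nonneg)
    have e': "e' > 0" using e B np by (simp add: e'_def)
    obtain d where d: "d > 0" "\<And>z. norm z < d \<Longrightarrow> norm (H z - D z) \<le> e' * norm z"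
      using der e' H0 unfolding has_derivative_at_alt by force
    have "norm (x - T (H (s, x)) - s *\<^sub>R p) \<le> e * s"
      if s: "0 \<le> s" "s < d / (2 + norm p)" and x: "x \<in> cball (s *\<^sub>R p) s" for s x
    proof -
      have "norm (x - s *\<^sub>R p) \<le> s" using x by (simp add: dist_norm norm_minus_commute)
      then have "norm x \<le> s + s * norm p"
        using norm_triangle_sub[of x "s *\<^sub>R p"] s by simp
      moreover have "norm (s, x) \<le> s + norm x" using norm_Pair_le[of s x] s by simp
      ultimately have z: "norm (s, x) \<le> s * (2 + norm p)" by (simp add: algebra_simps)
      also have "\<dots> < d" using s np by (simp add: pos_less_divide_eq)
      finally have "norm (H (s, x) - D (s, x)) \<le> e' * norm (s, x)" by (rule d(2))
      also have "\<dots> \<le> e' * (s * (2 + norm p))" using z e' by (intro mult_left_mono) auto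
      finally have r: "norm (H (s, x) - D (s, x)) \<le> e' * (s * (2 + norm p))" .
      have "D (s, x) = s *\<^sub>R D (1, 0) + D (0, x)"
        using D.add[of "s *\<^sub>R (1, 0)" "(0, x)"] D.scaleR[of s "(1, 0)"] by simp
      then have "T (D (s, x)) = - s *\<^sub>R p + x" by (simp add: T.add T.scaleR T(2) p_def)
      then have "x - T (H (s, x)) - s *\<^sub>R p = - T (H (s, x) - D (s, x))" by (simp add: T.diff)
      also have "norm \<dots> \<le> norm (H (s, x) - D (s, x)) * B" using B(2) by simp
      also have "\<dots> \<le> e' * (s * (2 + norm p)) * B" using r B by (intro mult_right_mono) auto
      also have "\<dots> = e * s" using B np by (simp add: e'_def)
      finally show ?thesis .
    qed
    then show ?thesis using d(1) np by (intro exI[of _ "d / (2 + norm p)"]) auto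
  qed
  obtain \<delta> where \<delta>: "\<delta> > 0" "\<And>s x. 0 \<le> s \<Longrightarrow> s < \<delta> \<Longrightarrow> x \<in> cball (s *\<^sub>R p) s \<Longrightarrow> norm (x - T (H (s, x)) - s *\<^sub>R p) \<le> s"
    using small[of 1] by auto
  have "\<exists>x. x \<in> cball (s *\<^sub>R p) s \<and> H (s, x) = 0" if s: "s \<in> {0..<\<delta>}" for s
  proof -
    obtain x where x: "x \<in> cball (s *\<^sub>R p) s" "x - T (H (s, x)) = x"
    proof (rule brouwer[of "cball (s *\<^sub>R p) s" "\<lambda>x. x - T (H (s, x))"])
      show "continuous_on (cball (s *\<^sub>R p) s) (\<lambda>x. x - T (H (s, x)))"
        using cont by (intro continuous_intros T.continuous_on) (auto intro: continuous_on_subset)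
      show "(\<lambda>x. x - T (H (s, x))) \<in> cball (s *\<^sub>R p) s \<rightarrow> cball (s *\<^sub>R p) s"
        using \<delta>(2)[of s] s by (force simp: dist_norm norm_minus_commute)
    qed (use s in auto)
    then show ?thesis using T(3) by auto
  qed
  then obtain \<sigma> where \<sigma>: "\<And>s. s \<in> {0..<\<delta>} \<Longrightarrow> \<sigma> s \<in> cball (s *\<^sub>R p) s \<and> H (s, \<sigma> s) = 0"
    by metis
  \<comment> \<open>At s = 0 the ball shrinks to the single point 0, so the pointwise choice has no
    freedom there.\<close>
  have \<sigma>0: "\<sigma> 0 = 0" using \<sigma>[of 0] \<delta>(1) by simp
  have "(\<sigma> has_vector_derivative p) (at 0 within {0..<\<delta>})"
    unfolding has_vector_derivative_def has_derivative_within_alt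
  proof (intro conjI allI impI)
    show "bounded_linear (\<lambda>x. x *\<^sub>R p)" by (rule bounded_linear_scaleR_left)
    fix e :: real assume "e > 0"
    from small[OF this] obtain d where d: "d > 0"
      "\<And>s x. 0 \<le> s \<Longrightarrow> s < d \<Longrightarrow> x \<in> cball (s *\<^sub>R p) s \<Longrightarrow> norm (x - T (H (s, x)) - s *\<^sub>R p) \<le> e * s"
      by blast
    \<comment> \<open>Since H (s, \<sigma> s) = 0, the value of the iteration map at \<sigma> s is
      \<sigma> s itself, and \<open>small\<close> bounds its distance from s p.\<close>
    have "norm (\<sigma> s - \<sigma> 0 - (s - 0) *\<^sub>R p) \<le> e * norm (s - 0)" if "s \<in> {0..<\<delta>}" "norm (s - 0) < d" for s
      using d(2)[of s "\<sigma> s"] \<sigma>[OF that(1)] that by (simp add: \<sigma>0 T.zero)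
    then show "\<exists>d>0. \<forall>y\<in>{0..<\<delta>}. norm (y - 0) < d \<longrightarrow> norm (\<sigma> y - \<sigma> 0 - (y - 0) *\<^sub>R p) \<le> e * norm (y - 0)"
      using d(1) by blast
  qed
  then show ?thesis using that \<delta>(1) \<sigma>0 \<sigma> unfolding p_def by blast
qed

text \<open>Only the infima of \<zeta> over the sets matter. \<open>base\<close> attains the infimum
  at s = 0 and bounds all later sets from below, while \<open>e s\<close> exceeds it by at most
  o(s). Hence each quotient set lies in \<open>Hplus \<zeta>\<close> and contains a half space whose
  level \<rho> k tends to 0.\<close>

lemma has_set_deriv_along_Hplus:
  fixes \<zeta> :: "real^'d" and f :: "'x \<Rightarrow> (real^'d) set"
  assumes \<zeta>: "\<zeta> \<noteq> 0"
    and base: "base \<in> f (\<gamma> 0)" "\<And>z. z \<in> f (\<gamma> 0) \<Longrightarrow> \<zeta> \<bullet> base \<le> \<zeta> \<bullet> z"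
    and e: "\<And>s. s \<in> {0..<\<delta>} \<Longrightarrow> e s \<in> f (\<gamma> s)"
      "\<And>s z. s \<in> {0..<\<delta>} \<Longrightarrow> z \<in> f (\<gamma> s) \<Longrightarrow> \<zeta> \<bullet> base \<le> \<zeta> \<bullet> z"
    and lim: "((\<lambda>s. (\<zeta> \<bullet> e s - \<zeta> \<bullet> base) / s) \<longlongrightarrow> 0) (at 0 within {0..<\<delta>})"
  shows "has_set_deriv_along \<zeta> f \<gamma> (Hplus \<zeta>) 0 {0..<\<delta>}"
  unfolding has_set_deriv_along_def has_set_lim_def
proof (intro allI impI)
  fix r :: "nat \<Rightarrow> real" assume r: "(\<forall>k. r k \<in> {0..<\<delta>} - {0}) \<and> r \<longlonglongrightarrow> 0"
  then have r0: "r k > 0" "r k \<in> {0..<\<delta>}" for k by (auto simp: less_le)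
  define \<rho> where "\<rho> k = (\<zeta> \<bullet> e (r k) - \<zeta> \<bullet> base) / r k" for k
  have \<rho>: "\<rho> \<longlonglongrightarrow> 0" unfolding \<rho>_def using r by (intro tendsto_at_imp_LIMSEQ[OF lim]) auto
  let ?D = "\<lambda>k. (\<lambda>z. (1 / (r k - 0)) *\<^sub>R z) ` set_diff_zeta (f (\<gamma> (r k))) \<zeta> (f (\<gamma> 0))"
  have upper: "0 \<le> \<zeta> \<bullet> z" if z: "z \<in> ?D k" for z k
  proof -
    obtain x where x: "z = (1 / r k) *\<^sub>R x" "x \<in> set_diff_zeta (f (\<gamma> (r k))) \<zeta> (f (\<gamma> 0))"
      using z by auto
    have "{x' + h | x' h. x' \<in> f (\<gamma> (r k)) \<and> h \<in> Hplus \<zeta>} \<subseteq> {y. \<zeta> \<bullet> base \<le> \<zeta> \<bullet> y}"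
      using e(2)[OF r0(2)[of k]] by (force simp: Hplus_def inner_add_right)
    moreover have "closed {y. \<zeta> \<bullet> base \<le> \<zeta> \<bullet> y}"
      using closed_halfspace_ge[of "\<zeta> \<bullet> base" \<zeta>] by simp
    ultimately have "closure {x' + h | x' h. x' \<in> f (\<gamma> (r k)) \<and> h \<in> Hplus \<zeta>} \<subseteq> {y. \<zeta> \<bullet> base \<le> \<zeta> \<bullet> y}"
      by (rule closure_minimal)
    moreover have "x + base \<in> closure {x' + h | x' h. x' \<in> f (\<gamma> (r k)) \<and> h \<in> Hplus \<zeta>}"
      using x(2) base(1) unfolding set_diff_zeta_def by blast
    ultimately have "\<zeta> \<bullet> base \<le> \<zeta> \<bullet> (x + base)" by blast
    then show ?thesis using x(1) r0(1)[of k] by (simp add: inner_add_right)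
  qed
  have lower: "z \<in> ?D k" if "\<rho> k \<le> \<zeta> \<bullet> z" for z k
  proof -
    have "\<zeta> \<bullet> e (r k) - \<zeta> \<bullet> base \<le> \<zeta> \<bullet> (r k *\<^sub>R z)"
      using that r0(1)[of k] by (simp add: \<rho>_def pos_divide_le_eq mult.commute)
    \<comment> \<open>Write r z + x as \<open>e (r k)\<close> plus a remainder; the remainder is in
      \<open>Hplus \<zeta>\<close> because \<zeta> takes on x at least its value on
      \<open>base\<close>.\<close>
    then have "r k *\<^sub>R z + x \<in> {x + h | x h. x \<in> f (\<gamma> (r k)) \<and> h \<in> Hplus \<zeta>}" if "x \<in> f (\<gamma> 0)" for x
      using base(2)[OF that] e(1)[OF r0(2)[of k]]
      by (intro CollectI exI[of _ "e (r k)"] exI[of _ "r k *\<^sub>R z + x - e (r k)"])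
        (auto simp: Hplus_def inner_add_right inner_diff_right)
    then have "r k *\<^sub>R z \<in> set_diff_zeta (f (\<gamma> (r k))) \<zeta> (f (\<gamma> 0))"
      using closure_subset unfolding set_diff_zeta_def by blast
    then show ?thesis using r0(1)[of k] by (intro image_eqI[of _ _ "r k *\<^sub>R z"]) auto
  qed
  show "set_seq_lim ?D = Hplus \<zeta>"
  proof (intro set_eqI iffI)
    fix z assume "z \<in> set_seq_lim ?D"
    then obtain x where x: "\<And>k. x k \<in> ?D k" "x \<longlonglongrightarrow> z" unfolding set_seq_lim_def by blast
    have "(\<lambda>k. \<zeta> \<bullet> x k) \<longlonglongrightarrow> \<zeta> \<bullet> z" by (intro tendsto_intros x)
    then have "0 \<le> \<zeta> \<bullet> z" using upper[OF x(1)] by (intro LIMSEQ_le_const) auto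
    then show "z \<in> Hplus \<zeta>" by (simp add: Hplus_def)
  next
    fix z assume z: "z \<in> Hplus \<zeta>"
    \<comment> \<open>Moving z along \<zeta> raises its \<zeta>-value by exactly \<rho> k, enough to
      enter the k-th quotient set, and the shift vanishes in the limit.\<close>
    define x where "x k = z + (\<rho> k / (\<zeta> \<bullet> \<zeta>)) *\<^sub>R \<zeta>" for k
    have "\<rho> k \<le> \<zeta> \<bullet> x k" for k
      using z \<zeta> by (simp add: x_def Hplus_def inner_add_right)
    then have "\<And>k. x k \<in> ?D k" by (rule lower)
    moreover have "x \<longlonglongrightarrow> z + (0 / (\<zeta> \<bullet> \<zeta>)) *\<^sub>R \<zeta>"
      unfolding x_def by (intro tendsto_intros \<rho>) (use \<zeta> in auto)
    ultimately show "z \<in> set_seq_lim ?D" unfolding set_seq_lim_def by auto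
  qed
qed

section \<open>Gradients, components and measurability of compositions\<close>

text \<open>Since \<open>grad\<close> is a definite description, it carries information only after
  existence (the Riesz vector in the standard basis) and uniqueness have been shown.\<close>

lemma has_derivative_eq_inner_grad:
  fixes f :: "'e::euclidean_space \<Rightarrow> real"
  assumes "(f has_derivative f') (at x)"
  shows "f' h = grad f x \<bullet> h"
proof -
  interpret f': bounded_linear f' using assms by (rule has_derivative_bounded_linear)
  have f': "f' h = h \<bullet> (\<Sum>b\<in>Basis. f' b *\<^sub>R b)" for h
  proof -
    have "f' h = f' (\<Sum>b\<in>Basis. (h \<bullet> b) *\<^sub>R b)" by (simp add: euclidean_representation)
    also have "\<dots> = (\<Sum>b\<in>Basis. (h \<bullet> b) * f' b)" by (simp add: f'.sum f'.scaleR)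
    finally show ?thesis by (simp add: inner_sum_right mult.commute)
  qed
  have 1: "GDERIV f x :> (\<Sum>b\<in>Basis. f' b *\<^sub>R b)"
    using assms unfolding gderiv_def by (subst (asm) ext[OF f', of "\<lambda>h. h"])
  have 2: "D = D'" if "GDERIV f x :> D" "GDERIV f x :> D'" for D D'
  proof -
    have "(\<lambda>h. h \<bullet> D) = (\<lambda>h. h \<bullet> D')"
      using that unfolding gderiv_def by (rule has_derivative_unique)
    then show ?thesis unfolding fun_eq_iff vector_eq_ldot .
  qed
  have "GDERIV f x :> grad f x"
    unfolding grad_def by (rule theI[where P="\<lambda>D. GDERIV f x :> D", OF 1 2[OF _ 1]])
  then have "f' = (\<lambda>h. h \<bullet> grad f x)"
    using assms unfolding gderiv_def by (intro has_derivative_unique)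
  then show ?thesis by (simp add: inner_commute)
qed

lemma integral_vec_nth:
  fixes f :: "'s \<Rightarrow> real^'n"
  assumes "integrable M f"
  shows "(LINT t|M. f t) $ i = (LINT t|M. f t $ i)"
  using integral_bounded_linear[OF bounded_linear_vec_nth assms, of i] by simp

lemma borel_measurable_continuous_on_compose:
  fixes f :: "'a::{second_countable_topology} \<Rightarrow> 'b::topological_space"
  assumes "continuous_on S f" "g \<in> borel_measurable M" "\<And>t. t \<in> space M \<Longrightarrow> g t \<in> S"
  shows "(\<lambda>t. f (g t)) \<in> borel_measurable M"
proof -
  have "g \<in> M \<rightarrow>\<^sub>M restrict_space borel S"
    using assms by (intro measurable_restrict_space2) auto
  from measurable_compose[OF this borel_measurable_continuous_on_restrict[OF assms(1)]]
  show ?thesis .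
qed

section \<open>Finite-dimensional variations\<close>

text \<open>The parameter is c = (s, \<sigma>). The same polymorphic expression serves for values at
  a time t and for the corresponding weak derivatives, and its linearity in c is what the
  differentiation lemma requires of \<open>U t\<close>.\<close>

definition lincomb :: "'e::real_vector \<Rightarrow> ('m::finite \<Rightarrow> 'e) \<Rightarrow> real \<times> (real^'m) \<Rightarrow> 'e" where
  "lincomb v w c = fst c *\<^sub>R v + (\<Sum>i\<in>UNIV. snd c $ i *\<^sub>R w i)"

lemma lincomb_10: "lincomb v w (1, 0) = v"
  by (simp add: lincomb_def)

lemma lincomb_axis: "lincomb v w (0, axis i 1) = w i"
proof -
  have "(\<Sum>j\<in>UNIV. axis i (1::real) $ j *\<^sub>R w j) = (\<Sum>j\<in>UNIV. if j = i then w j else 0)"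
    by (rule sum.cong) (auto simp: axis_def)
  then show ?thesis by (simp add: lincomb_def)
qed

lemma bounded_linear_lincomb:
  fixes v :: "'e::real_normed_vector" and w :: "'m::finite \<Rightarrow> 'e"
  shows "bounded_linear (lincomb v w)"
  unfolding lincomb_def[abs_def]
  by (intro bounded_linear_add bounded_linear_sum bounded_linear_scaleR_const bounded_linear_fst
      bounded_linear_compose[OF bounded_linear_vec_nth bounded_linear_snd])

lemma norm_lincomb_le:
  fixes v :: "'e::real_normed_vector" and w :: "'m::finite \<Rightarrow> 'e"
  shows "norm (lincomb v w c) \<le> (norm v + (\<Sum>i\<in>UNIV. norm (w i))) * norm c"
proof -
  have s: "\<bar>snd c $ i\<bar> \<le> norm c" for i
    using component_le_norm_cart[of "snd c" i] norm_snd_le[of "snd c" "fst c"] by simp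
  have "norm (lincomb v w c) \<le> norm (fst c *\<^sub>R v) + norm (\<Sum>i\<in>UNIV. snd c $ i *\<^sub>R w i)"
    unfolding lincomb_def by (rule norm_triangle_ineq)
  also have "norm (fst c *\<^sub>R v) \<le> norm v * norm c"
    using mult_right_mono[OF norm_fst_le[of "fst c" "snd c"] norm_ge_zero[of v]] by (simp add: mult.commute)
  also have "norm (\<Sum>i\<in>UNIV. snd c $ i *\<^sub>R w i) \<le> (\<Sum>i\<in>UNIV. norm (w i) * norm c)"
    by (intro sum_norm_le) (simp add: mult.commute[of _ "norm c"] mult_right_mono s)
  finally show ?thesis by (simp add: distrib_right sum_distrib_right)
qed

lemma linear_prod_vec_expand:
  fixes D :: "real \<times> (real^'m) \<Rightarrow> 'f::real_vector"
  assumes "linear D"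
  shows "D (s, x) = s *\<^sub>R D (1, 0) + (\<Sum>i\<in>UNIV. x $ i *\<^sub>R D (0, axis i 1))"
proof -
  have "x = (\<Sum>i\<in>UNIV. x $ i *\<^sub>R axis i 1)"
    using basis_expansion[of x] by (simp add: scalar_mult_eq_scaleR)
  then have "(s, x) = s *\<^sub>R (1, 0) + (\<Sum>i\<in>UNIV. x $ i *\<^sub>R (0, axis i 1))"
    by (intro prod_eqI) (simp_all add: fst_sum snd_sum)
  then have "D (s, x) = D (s *\<^sub>R (1, 0) + (\<Sum>i\<in>UNIV. x $ i *\<^sub>R (0, axis i 1)))" by (rule arg_cong)
  also have "\<dots> = s *\<^sub>R D (1, 0) + (\<Sum>i\<in>UNIV. x $ i *\<^sub>R D (0, axis i 1))"
    unfolding linear_add[OF assms] linear_scale[OF assms] linear_sum[OF assms] ..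
  finally show ?thesis .
qed

lemma finite_measure_lebesgue_on_Icc: "finite_measure (lebesgue_on {a..b::real})"
  using finite_measure_lebesgue_on[OF lmeasurable_cbox[of a b]] by simp

lemma continuous_on_Icc_integrable:
  fixes f :: "real \<Rightarrow> 'e::euclidean_space"
  assumes "continuous_on {a..b} f" "0 \<le> q"
  shows "f \<in> borel_measurable (lebesgue_on {a..b})" "integrable (lebesgue_on {a..b}) f"
    "integrable (lebesgue_on {a..b}) (\<lambda>t. norm (f t) powr q)"
proof -
  interpret finite_measure "lebesgue_on {a..b}" by (rule finite_measure_lebesgue_on_Icc)
  show m: "f \<in> borel_measurable (lebesgue_on {a..b})"
    using assms by (intro continuous_imp_measurable_on_sets_lebesgue) auto
  have "bounded (f ` {a..b})"
    using assms by (intro compact_imp_bounded compact_continuous_image) auto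
  then obtain B where B: "\<forall>t\<in>{a..b}. norm (f t) \<le> B" unfolding bounded_iff by blast
  show "integrable (lebesgue_on {a..b}) f"
    using B by (intro integrable_const_bound[OF _ m, of B] AE_I2) simp
  have "norm (norm (f t) powr q) \<le> B powr q" if "t \<in> {a..b}" for t
    using B that assms(2) by (simp add: powr_mono2)
  then show "integrable (lebesgue_on {a..b}) (\<lambda>t. norm (f t) powr q)"
    using m by (intro integrable_const_bound[of _ "B powr q"] AE_I2) simp_all
qed

text \<open>Growth is assumed for the two partial gradients of L, whereas differentiation under the
  integral needs the joint derivative in (y, p); this formula links them and also produces the
  integrand of \<open>EL\<close>.\<close>

lemma has_derivative_partial_grads:
  fixes l :: "'e::euclidean_space \<times> 'e \<Rightarrow> real"
  assumes "(l has_derivative D) (at (x, p))"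
  shows "D (h, k) = grad (\<lambda>x. l (x, p)) x \<bullet> h + grad (\<lambda>p. l (x, p)) p \<bullet> k"
proof -
  have "((\<lambda>x. (x, p)) has_derivative (\<lambda>h. (h, 0))) (at x)"
    by (auto intro!: derivative_eq_intros)
  from has_derivative_compose[OF this assms]
  have "D (h, 0) = grad (\<lambda>x. l (x, p)) x \<bullet> h" by (rule has_derivative_eq_inner_grad)
  moreover have "((\<lambda>p. (x, p)) has_derivative (\<lambda>k. (0, k))) (at p)"
    by (auto intro!: derivative_eq_intros)
  from has_derivative_compose[OF this assms]
  have "D (0, k) = grad (\<lambda>p. l (x, p)) p \<bullet> k" by (rule has_derivative_eq_inner_grad)
  moreover have "D (h, k) = D (h, 0) + D (0, k)"
    using linear_add[OF has_derivative_linear[OF assms], of "(h, 0)" "(0, k)"] by simp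
  ultimately show ?thesis by simp
qed

text \<open>The derivative is taken within \<open>T \<times> UNIV\<close>, one-sided in time at an
  endpoint of an interval. Restricted to a slice with t fixed, which is a full copy of the space, it
  becomes an ordinary derivative.\<close>

lemma C1_on_slice_derivative:
  fixes f :: "'s::real_normed_vector \<times> 'e::real_normed_vector \<Rightarrow> 'f::real_normed_vector"
  assumes "C1_on (T \<times> UNIV) f"
  obtains f' where "\<And>t z. t \<in> T \<Longrightarrow> ((\<lambda>z. f (t, z)) has_derivative f' t z) (at z)"
proof -
  obtain f' :: "'s \<times> 'e \<Rightarrow> ('s \<times> 'e) \<Rightarrow>\<^sub>L 'f" where
    f': "\<And>x. x \<in> T \<times> UNIV \<Longrightarrow> (f has_derivative blinfun_apply (f' x)) (at x within T \<times> UNIV)"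
    using assms unfolding C1_on_def by blast
  have "((\<lambda>z. f (t, z)) has_derivative (\<lambda>h. blinfun_apply (f' (t, z)) (0, h))) (at z)" if t: "t \<in> T" for t z
  proof -
    have 1: "((\<lambda>z. (t, z)) has_derivative (\<lambda>h. (0, h))) (at z)"
      by (auto intro!: derivative_eq_intros)
    have "(f has_derivative blinfun_apply (f' (t, z))) (at (t, z) within range (\<lambda>z. (t, z)))"
      using t by (intro has_derivative_subset[OF f']) auto
    from has_derivative_in_compose[OF 1 this] show ?thesis .
  qed
  then show ?thesis by (rule that)
qed

section \<open>The integral constraint on the variations\<close>

lemma hfun_has_derivative:
  fixes G :: "real^'n \<Rightarrow> real^'m" and v :: "real \<Rightarrow> real^'n"
  assumes q: "1 < q"
    and dG: "\<And>x. G differentiable (at x)"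
    and bG: "\<And>x i. norm (gradG G i x) \<le> K * (norm x powr (q - 1) + 1)"
    and cont: "continuous_on {a..b} y" "continuous_on {a..b} v" "\<And>i. continuous_on {a..b} (w i)"
  shows "((\<lambda>c. hfun a b G y w v (fst c) (snd c)) has_derivative
    (\<lambda>c. fst c *\<^sub>R (\<chi> i. LINT t|lebesgue_on {a..b}. gradG G i (y t) \<bullet> v t) + Wmat a b G y w *v snd c)) (at 0)"
proof -
  let ?M = "lebesgue_on {a..b}"
  define G' where "G' x = frechet_derivative G (at x)" for x
  have G': "(G has_derivative G' x) (at x)" for x
    using dG[of x] unfolding G'_def by (simp add: frechet_derivative_works)
  have G'i: "G' x h $ i = gradG G i x \<bullet> h" for x h i
    unfolding gradG_def
    by (rule has_derivative_eq_inner_grad[of _ "\<lambda>h. G' x h $ i"]) (rule bounded_linear.has_derivative[OF bounded_linear_vec_nth G'])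
  have contG: "continuous_on UNIV G"
    using has_derivative_continuous[OF G'] by (simp add: continuous_on_eq_continuous_at)
  define U where "U t = lincomb (v t) (\<lambda>i. w i t)" for t
  define u where "u t = norm (v t) + (\<Sum>i\<in>UNIV. norm (w i t))" for t
  have cU: "continuous_on {a..b} (\<lambda>t. U t c)" for c
    unfolding U_def lincomb_def using cont by (intro continuous_intros) auto
  have cu: "continuous_on {a..b} u"
    unfolding u_def using cont by (intro continuous_intros) auto
  have u0: "u t \<ge> 0" for t by (simp add: u_def sum_nonneg)
  have q0: "0 \<le> q" using q by simp
  have cGU: "continuous_on {a..b} (\<lambda>t. G (y t + U t c))" for c
    using continuous_on_compose2[OF contG continuous_on_add[OF cont(1) cU]] by simp
  have cGy: "continuous_on {a..b} (\<lambda>t. G (y t))"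
    using continuous_on_compose2[OF contG cont(1)] by simp
  \<comment> \<open>The factor \<open>CARD('m)\<close> comes from estimating the norm by the sum of
    the components, for which the gradient bounds are available.\<close>
  have bd: "norm (G' x h) \<le> (of_nat CARD('m) * K) * (norm x powr (q - 1) + 1) * norm h" for x h
  proof -
    have "norm (G' x h) \<le> (\<Sum>i\<in>UNIV. \<bar>G' x h $ i\<bar>)" by (rule norm_le_l1_cart)
    also have "\<dots> \<le> (\<Sum>i\<in>(UNIV::'m set). K * (norm x powr (q - 1) + 1) * norm h)"
    proof (rule sum_mono)
      fix i :: 'm
      have "\<bar>G' x h $ i\<bar> \<le> norm (gradG G i x) * norm h" unfolding G'i by (rule Cauchy_Schwarz_ineq2)
      also have "\<dots> \<le> K * (norm x powr (q - 1) + 1) * norm h" using bG by (rule mult_right_mono) simp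
      finally show "\<bar>G' x h $ i\<bar> \<le> K * (norm x powr (q - 1) + 1) * norm h" .
    qed
    finally show ?thesis by (simp add: mult.assoc)
  qed
  have U: "bounded_linear (U t)" "norm (U t c) \<le> u t * norm c" for t c
    unfolding U_def u_def by (rule bounded_linear_lincomb, rule norm_lincomb_le)
  note R = has_derivative_integral_growth[of ?M q "\<lambda>t. G" y U u "\<lambda>t. G'" "of_nat CARD('m) * K",
      OF finite_measure_lebesgue_on_Icc less_imp_le[OF q] continuous_on_Icc_integrable(1)[OF cGU q0]
      continuous_on_Icc_integrable(2)[OF cGy q0]
      measurable_compose[OF continuous_on_Icc_integrable(1)[OF cont(1) q0] borel_measurable_norm]
      continuous_on_Icc_integrable(3)[OF cont(1) q0]
      continuous_on_Icc_integrable(1)[OF cu q0] u0 _ U G' bd]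
  have ui: "integrable ?M (\<lambda>t. u t powr q)"
    using continuous_on_Icc_integrable(3)[OF cu q0] u0 by simp
  let ?D = "\<lambda>c. LINT t|?M. G' (y t) (U t c)"
  have D: "((\<lambda>c. LINT t|?M. G (y t + U t c)) has_derivative ?D) (at 0)"
    by (rule R(2)[OF ui])
  have Di: "?D c $ i = (LINT t|?M. gradG G i (y t) \<bullet> U t c)" for c i
    using integral_vec_nth[OF R(1)[OF ui]] by (simp add: G'i)
  have D10: "?D (1, 0) = (\<chi> i. LINT t|?M. gradG G i (y t) \<bullet> v t)"
    using Di[of "(1, 0)"] by (simp add: vec_eq_iff U_def lincomb_10)
  have Da: "?D (0, axis j 1) $ i = Wmat a b G y w $ i $ j" for i j
    using Di[of "(0, axis j 1)" i] by (simp add: U_def lincomb_axis Wmat_def)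
  have "?D c = fst c *\<^sub>R ?D (1, 0) + Wmat a b G y w *v snd c" for c
  proof -
    have "(\<Sum>j\<in>UNIV. snd c $ j *\<^sub>R ?D (0, axis j 1)) = Wmat a b G y w *v snd c"
      by (simp add: vec_eq_iff Da matrix_vector_mult_def mult.commute)
    then show ?thesis
      using linear_prod_vec_expand[OF has_derivative_linear[OF D], of "fst c" "snd c"] by simp
  qed
  then have "?D = (\<lambda>c. fst c *\<^sub>R (\<chi> i. LINT t|?M. gradG G i (y t) \<bullet> v t) + Wmat a b G y w *v snd c)"
    unfolding D10 by (rule ext)
  moreover have "(\<lambda>c. LINT t|?M. G (y t + U t c)) = (\<lambda>c. hfun a b G y w v (fst c) (snd c))"
    by (simp add: fun_eq_iff hfun_def U_def lincomb_def add.assoc)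
  ultimately show ?thesis using D by simp
qed

text \<open>Differentiability at the origin is known for every continuous base curve. Absorbing
  \<open>c0\<close> into the base curve therefore gives continuity at \<open>c0\<close>, as
  Brouwer's theorem demands away from the origin.\<close>

lemma hfun_continuous:
  fixes G :: "real^'n \<Rightarrow> real^'m" and v :: "real \<Rightarrow> real^'n"
  assumes "1 < q" "\<And>x. G differentiable (at x)"
    and "\<And>x i. norm (gradG G i x) \<le> K * (norm x powr (q - 1) + 1)"
    and cont: "continuous_on {a..b} y" "continuous_on {a..b} v" "\<And>i. continuous_on {a..b} (w i)"
  shows "continuous_on UNIV (\<lambda>c. hfun a b G y w v (fst c) (snd c))"
proof -
  have "isCont (\<lambda>c. hfun a b G y w v (fst c) (snd c)) c0" for c0
  proof -
    let ?y = "\<lambda>t. y t + lincomb (v t) (\<lambda>i. w i t) c0"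
    have "continuous_on {a..b} ?y"
      unfolding lincomb_def using cont by (intro continuous_intros) auto
    from has_derivative_continuous[OF hfun_has_derivative[OF assms(1-3) this cont(2,3)]]
    have "isCont (\<lambda>c. hfun a b G ?y w v (fst c) (snd c)) 0" by simp
    moreover have "hfun a b G ?y w v (fst c) (snd c) = hfun a b G y w v (fst (c0 + c)) (snd (c0 + c))" for c
      by (simp add: hfun_def lincomb_def algebra_simps sum.distrib)
    ultimately show ?thesis by (simp add: isCont_def LIM_offset_zero_cancel[of _ c0])
  qed
  then show ?thesis by (simp add: continuous_on_eq_continuous_at)
qed

lemma W1q_lincomb:
  fixes y v :: "real \<Rightarrow> real^'n" and w :: "'m::finite \<Rightarrow> real \<Rightarrow> real^'n"
  assumes "y \<in> W1q a b q" "v \<in> W1q a b q" "\<And>i. w i \<in> W1q a b q" "0 \<le> q"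
  shows "(\<lambda>t. y t + lincomb (v t) (\<lambda>i. w i t) c) \<in> W1q a b q"
    "is_weak_deriv a b (\<lambda>t. y t + lincomb (v t) (\<lambda>i. w i t) c)
       (\<lambda>t. weak_deriv a b y t + lincomb (weak_deriv a b v t) (\<lambda>i. weak_deriv a b (w i) t) c)"
  unfolding lincomb_def
  by (intro W1q_add W1q_sum W1q_scaleR assms finite)
    (intro is_weak_deriv_add is_weak_deriv_sum is_weak_deriv_scaleR W1q_weak_deriv(1)[of _ a b q] assms finite)

section \<open>The scalarized objective on the variations\<close>

lemma L_measurable:
  fixes L :: "real \<Rightarrow> real^'n \<Rightarrow> real^'n \<Rightarrow> real^'d"
  assumes "C1_on ({a..b} \<times> UNIV \<times> UNIV) (\<lambda>(t, y, p). L t y p)"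
    and "y \<in> borel_measurable (lebesgue_on {a..b})" "p \<in> borel_measurable (lebesgue_on {a..b})"
  shows "(\<lambda>t. L t (y t) (p t)) \<in> borel_measurable (lebesgue_on {a..b})"
proof -
  have "continuous_on ({a..b} \<times> UNIV \<times> UNIV) (\<lambda>(t, y, p). L t y p)"
    using assms(1) has_derivative_continuous unfolding C1_on_def continuous_on_eq_continuous_within by blast
  moreover have "(\<lambda>t. t) \<in> borel_measurable (lebesgue_on {a..b})"
    using id_borel_measurable_lebesgue_on[of "{a..b}"] by (simp add: id_def)
  then have "(\<lambda>t. (t, y t, p t)) \<in> borel_measurable (lebesgue_on {a..b})"
    using assms(2,3) by (intro borel_measurable_Pair)
  ultimately have "(\<lambda>t. (\<lambda>(t, y, p). L t y p) (t, y t, p t)) \<in> borel_measurable (lebesgue_on {a..b})"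
    by (rule borel_measurable_continuous_on_compose) auto
  then show ?thesis by simp
qed

lemma L_integrable:
  fixes L :: "real \<Rightarrow> real^'n \<Rightarrow> real^'n \<Rightarrow> real^'d"
  assumes "C1_on ({a..b} \<times> UNIV \<times> UNIV) (\<lambda>(t, y, p). L t y p)"
    and b: "\<And>t y p i. t \<in> {a..b} \<Longrightarrow> \<bar>L t y p $ i\<bar> \<le> K1 * (norm y powr q + norm p powr q + 1)"
    and y: "y \<in> borel_measurable (lebesgue_on {a..b})" "integrable (lebesgue_on {a..b}) (\<lambda>t. norm (y t) powr q)"
    and p: "p \<in> borel_measurable (lebesgue_on {a..b})" "integrable (lebesgue_on {a..b}) (\<lambda>t. norm (p t) powr q)"
  shows "integrable (lebesgue_on {a..b}) (\<lambda>t. L t (y t) (p t))"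
proof (rule Bochner_Integration.integrable_bound[OF _ L_measurable[OF assms(1) y(1) p(1)]])
  interpret finite_measure "lebesgue_on {a..b}" by (rule finite_measure_lebesgue_on_Icc)
  let ?g = "\<lambda>t. of_nat CARD('d) * (K1 * (norm (y t) powr q + norm (p t) powr q + 1))"
  show "integrable (lebesgue_on {a..b}) ?g" using y p by simp
  have "norm (L t (y t) (p t)) \<le> ?g t" if "t \<in> {a..b}" for t
  proof -
    have "norm (L t (y t) (p t)) \<le> (\<Sum>i\<in>UNIV. \<bar>L t (y t) (p t) $ i\<bar>)" by (rule norm_le_l1_cart)
    also have "\<dots> \<le> (\<Sum>i\<in>(UNIV::'d set). K1 * (norm (y t) powr q + norm (p t) powr q + 1))"
      by (rule sum_mono) (rule b[OF that])
    finally show ?thesis by simp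
  qed
  then show "AE t in lebesgue_on {a..b}. norm (L t (y t) (p t)) \<le> norm (?g t)"
    by (intro AE_I2) (force intro: order_trans[OF _ abs_ge_self])
qed

text \<open>Lets the arbitrary choice inside \<open>J\<close> be replaced by any weak derivative, in
  particular by the combination of the chosen ones, which depends affinely on the parameter.\<close>

lemma J_eq_integral:
  fixes L :: "real \<Rightarrow> real^'n \<Rightarrow> real^'n \<Rightarrow> real^'d"
  assumes C1: "C1_on ({a..b} \<times> UNIV \<times> UNIV) (\<lambda>(t, y, p). L t y p)"
    and b: "\<And>t y p i. t \<in> {a..b} \<Longrightarrow> \<bar>L t y p $ i\<bar> \<le> K1 * (norm y powr q + norm p powr q + 1)"
    and q: "0 \<le> q" and y: "y \<in> W1q a b q" and g: "is_weak_deriv a b y g"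
  shows "\<zeta> \<bullet> J a b L y = (LINT t|lebesgue_on {a..b}. \<zeta> \<bullet> L t (y t) (g t))"
proof -
  have cy: "continuous_on {a..b} y" using y by (simp add: W1q_def)
  note my = continuous_on_Icc_integrable[OF cy q]
  have wd: "weak_deriv a b y \<in> borel_measurable (lebesgue_on {a..b})"
    "integrable (lebesgue_on {a..b}) (\<lambda>t. norm (weak_deriv a b y t) powr q)"
    using W1q_weak_deriv(2)[OF y] by (auto simp: Lq_def)
  have mg: "g \<in> borel_measurable (lebesgue_on {a..b})" using g by (auto simp: is_weak_deriv_def)
  have "\<zeta> \<bullet> J a b L y = (LINT t|lebesgue_on {a..b}. \<zeta> \<bullet> L t (y t) (weak_deriv a b y t))"
    unfolding J_def using L_integrable[OF C1 b my(1,3) wd] by simp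
  also have "\<dots> = (LINT t|lebesgue_on {a..b}. \<zeta> \<bullet> L t (y t) (g t))"
  proof (rule integral_cong_AE)
    show "(\<lambda>t. \<zeta> \<bullet> L t (y t) (weak_deriv a b y t)) \<in> borel_measurable (lebesgue_on {a..b})"
      "(\<lambda>t. \<zeta> \<bullet> L t (y t) (g t)) \<in> borel_measurable (lebesgue_on {a..b})"
      by (intro borel_measurable_inner borel_measurable_const L_measurable[OF C1] my(1) mg wd(1))+
    show "AE t in lebesgue_on {a..b}. \<zeta> \<bullet> L t (y t) (weak_deriv a b y t) = \<zeta> \<bullet> L t (y t) (g t)"
      using is_weak_deriv_unique[OF W1q_weak_deriv(1)[OF y] g] by eventually_elim simp
  qed
  finally show ?thesis .
qed

lemma J_has_derivative:
  fixes L :: "real \<Rightarrow> real^'n \<Rightarrow> real^'n \<Rightarrow> real^'d" and w :: "'m::finite \<Rightarrow> real \<Rightarrow> real^'n"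
  assumes q: "1 < q"
    and C1: "C1_on ({a..b} \<times> UNIV \<times> UNIV) (\<lambda>(t, y, p). L t y p)"
    and b: "\<And>t y p i. t \<in> {a..b} \<Longrightarrow> \<bar>L t y p $ i\<bar> \<le> K1 * (norm y powr q + norm p powr q + 1)"
    and bp: "\<And>t y p i. t \<in> {a..b} \<Longrightarrow>
           norm (grad (\<lambda>p. L t y p $ i) p) \<le> K2 * (norm y powr (q - 1) + norm p powr (q - 1) + 1)"
    and bgy: "\<And>t y p i. t \<in> {a..b} \<Longrightarrow>
           norm (grad (\<lambda>y. L t y p $ i) y) \<le> K2 * (norm y powr (q - 1) + norm p powr (q - 1) + 1)"
    and W: "y \<in> W1q a b q" "v \<in> W1q a b q" "\<And>i. w i \<in> W1q a b q"
  shows "((\<lambda>c. \<zeta> \<bullet> J a b L (\<lambda>t. y t + lincomb (v t) (\<lambda>i. w i t) c)) has_derivative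
    (\<lambda>c. fst c * EL a b L \<zeta> y v + (\<Sum>i\<in>UNIV. snd c $ i * EL a b L \<zeta> y (w i)))) (at 0)"
proof -
  let ?M = "lebesgue_on {a..b}"
  have q0: "0 \<le> q" using q by simp
  obtain L' where "\<And>t z. t \<in> {a..b} \<Longrightarrow> ((\<lambda>z. (\<lambda>(t, y, p). L t y p) (t, z)) has_derivative L' t z) (at z)"
    by (rule C1_on_slice_derivative[OF C1[unfolded UNIV_Times_UNIV]]) (rule that)
  then have L': "((\<lambda>z. L t (fst z) (snd z)) has_derivative L' t z) (at z)" if "t \<in> {a..b}" for t z
    using that by (simp add: case_prod_beta)
  define F where "F t z = \<zeta> \<bullet> L t (fst z) (snd z)" for t z
  define F' where "F' t z h = \<zeta> \<bullet> L' t z h" for t z h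
  have dF: "(F t has_derivative F' t z) (at z)" if "t \<in> {a..b}" for t z
    unfolding F_def[abs_def] F'_def[abs_def]
    by (rule bounded_linear.has_derivative[OF bounded_linear_inner_right L'[OF that]])
  \<comment> \<open>One factor 2 in \<open>4 * \<bar>K2\<bar>\<close> comes from bounding both |x|
    and |p| by |z|, the other from adding the two partial gradients; the sum over |\<zeta> $ i|
    combines the components of L.\<close>
  have bd: "norm (F' t z h) \<le> ((\<Sum>i\<in>UNIV. \<bar>\<zeta> $ i\<bar>) * (4 * \<bar>K2\<bar>)) * (norm z powr (q - 1) + 1) * norm h"
    if t: "t \<in> {a..b}" for t z h
  proof -
    obtain x p where z: "z = (x, p)" by (cases z)
    obtain h1 h2 where h: "h = (h1, h2)" by (cases h)
    let ?N = "4 * \<bar>K2\<bar> * (norm z powr (q - 1) + 1) * norm h"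
    have comp: "\<bar>L' t z h $ i\<bar> \<le> ?N" for i
    proof -
      have "((\<lambda>z. L t (fst z) (snd z) $ i) has_derivative (\<lambda>h. L' t z h $ i)) (at z)"
        by (rule bounded_linear.has_derivative[OF bounded_linear_vec_nth L'[OF t]])
      then have "L' t z h $ i = grad (\<lambda>x. L t x p $ i) x \<bullet> h1 + grad (\<lambda>p. L t x p $ i) p \<bullet> h2"
        using has_derivative_partial_grads[of "\<lambda>z. L t (fst z) (snd z) $ i" "\<lambda>h. L' t z h $ i" x p h1 h2]
        unfolding z h by simp
      moreover let ?P = "2 * \<bar>K2\<bar> * (norm z powr (q - 1) + 1)"
      have P: "K2 * (norm x powr (q - 1) + norm p powr (q - 1) + 1) \<le> ?P"
      proof -
        have "norm x \<le> norm z" "norm p \<le> norm z"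
          unfolding z by (rule norm_fst_le, rule norm_snd_le)
        then have "norm x powr (q - 1) \<le> norm z powr (q - 1)" "norm p powr (q - 1) \<le> norm z powr (q - 1)"
          using q by (auto intro!: powr_mono2)
        then have "norm x powr (q - 1) + norm p powr (q - 1) + 1 \<le> 2 * (norm z powr (q - 1) + 1)" by simp
        then have "\<bar>K2\<bar> * (norm x powr (q - 1) + norm p powr (q - 1) + 1) \<le> \<bar>K2\<bar> * (2 * (norm z powr (q - 1) + 1))"
          by (intro mult_left_mono) auto
        moreover have "K2 * (norm x powr (q - 1) + norm p powr (q - 1) + 1) \<le> \<bar>K2\<bar> * (norm x powr (q - 1) + norm p powr (q - 1) + 1)"
          by (intro mult_right_mono) auto
        ultimately show ?thesis by (simp add: algebra_simps)
      qed
      have "\<bar>grad (\<lambda>x. L t x p $ i) x \<bullet> h1\<bar> \<le> ?P * norm h"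
        using order_trans[OF Cauchy_Schwarz_ineq2 mult_mono[OF order_trans[OF bgy[OF t] P] _ _ norm_ge_zero]]
          norm_fst_le[of h1 h2] unfolding h by simp
      moreover have "\<bar>grad (\<lambda>p. L t x p $ i) p \<bullet> h2\<bar> \<le> ?P * norm h"
        using order_trans[OF Cauchy_Schwarz_ineq2 mult_mono[OF order_trans[OF bp[OF t] P] _ _ norm_ge_zero]]
          norm_snd_le[of h2 h1] unfolding h by simp
      ultimately show ?thesis by (simp add: mult.assoc)
    qed
    have "norm (F' t z h) = \<bar>\<Sum>i\<in>UNIV. \<zeta> $ i * L' t z h $ i\<bar>"
      by (simp add: F'_def inner_vec_def)
    also have "\<dots> \<le> (\<Sum>i\<in>UNIV. \<bar>\<zeta> $ i\<bar> * \<bar>L' t z h $ i\<bar>)"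
      using sum_abs[of "\<lambda>i. \<zeta> $ i * L' t z h $ i" UNIV] by (simp add: abs_mult)
    also have "\<dots> \<le> (\<Sum>i\<in>UNIV. \<bar>\<zeta> $ i\<bar> * ?N)"
      by (intro sum_mono mult_left_mono comp) simp
    also have "\<dots> = (\<Sum>i\<in>UNIV. \<bar>\<zeta> $ i\<bar>) * ?N" by (rule sum_distrib_right[symmetric])
    finally show ?thesis by (simp only: mult.assoc)
  qed
  define x0 where "x0 t = (y t, weak_deriv a b y t)" for t
  define U where "U t c = (lincomb (v t) (\<lambda>i. w i t) c, lincomb (weak_deriv a b v t) (\<lambda>i. weak_deriv a b (w i) t) c)"
    for t and c :: "real \<times> (real^'m)"
  define u where "u t = (norm (v t) + (\<Sum>i\<in>UNIV. norm (w i t)))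
    + (norm (weak_deriv a b v t) + (\<Sum>i\<in>UNIV. norm (weak_deriv a b (w i) t)))" for t
  have m: "z \<in> borel_measurable ?M" "integrable ?M (\<lambda>t. norm (z t) powr q)"
    "weak_deriv a b z \<in> borel_measurable ?M" "integrable ?M (\<lambda>t. norm (weak_deriv a b z t) powr q)"
    if "z \<in> W1q a b q" for z :: "real \<Rightarrow> real^'n"
    using that continuous_on_Icc_integrable[of a b z q] W1q_weak_deriv(2)[OF that] q0
    by (auto simp: W1q_def Lq_def)
  note nm = measurable_compose[OF m(1) borel_measurable_norm] measurable_compose[OF m(3) borel_measurable_norm]
  have x0n: "norm (x0 t) \<le> norm (y t) + norm (weak_deriv a b y t)" for t
    unfolding x0_def by (rule norm_Pair_le)
  have x0m: "(\<lambda>t. norm (x0 t)) \<in> borel_measurable ?M"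
    unfolding x0_def using m(1,3)[OF W(1)] by (intro measurable_compose[OF borel_measurable_Pair borel_measurable_norm])
  have x0i: "integrable ?M (\<lambda>t. norm (x0 t) powr q)"
  proof (rule Bochner_Integration.integrable_bound)
    show "integrable ?M (\<lambda>t. (norm (y t) + norm (weak_deriv a b y t)) powr q)"
      using m[OF W(1)] q0 by (intro integrable_powr_add) auto
    show "AE t in ?M. norm (norm (x0 t) powr q) \<le> norm ((norm (y t) + norm (weak_deriv a b y t)) powr q)"
      using powr_mono2[OF q0 norm_ge_zero x0n] by (intro AE_I2) simp
    show "(\<lambda>t. norm (x0 t) powr q) \<in> borel_measurable ?M" using x0m by measurable
  qed
  have um: "u \<in> borel_measurable ?M"
    unfolding u_def[abs_def]
    by (intro borel_measurable_add borel_measurable_sum nm W)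
  have u0: "0 \<le> u t" for t unfolding u_def by (intro add_nonneg_nonneg sum_nonneg) auto
  have ui: "integrable ?M (\<lambda>t. u t powr q)"
    unfolding u_def[abs_def] using q0
    by (intro integrable_powr_add integrable_powr_sum borel_measurable_add borel_measurable_sum nm m W
        add_nonneg_nonneg sum_nonneg norm_ge_zero finite)
  have Ubl: "bounded_linear (U t)" for t
    unfolding U_def[abs_def] by (intro bounded_linear_Pair bounded_linear_lincomb)
  have Un: "norm (U t c) \<le> u t * norm c" for t c
    unfolding U_def u_def distrib_right[of _ _ "norm c"]
    using order_trans[OF norm_Pair_le add_mono[OF norm_lincomb_le norm_lincomb_le]]
    by (simp add: distrib_right)
  have Fm: "(\<lambda>t. F t (x0 t + U t c)) \<in> borel_measurable ?M" for c
  proof -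
    have "(\<lambda>t. L t (y t + lincomb (v t) (\<lambda>i. w i t) c)
       (weak_deriv a b y t + lincomb (weak_deriv a b v t) (\<lambda>i. weak_deriv a b (w i) t) c)) \<in> borel_measurable ?M"
      unfolding lincomb_def
      by (intro L_measurable[OF C1] borel_measurable_add borel_measurable_sum borel_measurable_scaleR
          borel_measurable_const m W)
    then show ?thesis
      unfolding F_def x0_def U_def fst_add snd_add fst_conv snd_conv
      by (intro borel_measurable_inner borel_measurable_const)
  qed
  have F0: "integrable ?M (\<lambda>t. F t (x0 t))"
    unfolding F_def x0_def fst_conv snd_conv
    using L_integrable[OF C1 b m[OF W(1)]] by simp
  note R = has_derivative_integral_growth[of ?M q F x0 U u F', OF finite_measure_lebesgue_on_Icc
      less_imp_le[OF q] Fm F0 x0m x0i um u0 ui Ubl Un]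
  let ?D = "\<lambda>c. LINT t|?M. F' t (x0 t) (U t c)"
  have D: "((\<lambda>c. LINT t|?M. F t (x0 t + U t c)) has_derivative ?D) (at 0)"
  proof (rule R(2))
    show "(F t has_derivative F' t z) (at z)" if "t \<in> space ?M" for t z
      using dF that by simp
    show "norm (F' t z h) \<le> ((\<Sum>i\<in>UNIV. \<bar>\<zeta> $ i\<bar>) * (4 * \<bar>K2\<bar>)) * (norm z powr (q - 1) + 1) * norm h"
      if "t \<in> space ?M" for t z h
      using bd that unfolding space_lebesgue_on by blast
  qed
  have F'g: "F' t (x0 t) (h, k) = grad (\<lambda>x. \<zeta> \<bullet> L t x (weak_deriv a b y t)) (y t) \<bullet> h
     + grad (\<lambda>p. \<zeta> \<bullet> L t (y t) p) (weak_deriv a b y t) \<bullet> k" if "t \<in> {a..b}" for t h k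
    using has_derivative_partial_grads[OF dF[OF that, of "(y t, weak_deriv a b y t)"]]
    by (simp add: F_def x0_def)
  have D10: "?D (1, 0) = EL a b L \<zeta> y v"
    unfolding EL_def by (rule Bochner_Integration.integral_cong) (simp_all add: F'g U_def lincomb_10)
  have Da: "?D (0, axis i 1) = EL a b L \<zeta> y (w i)" for i
    unfolding EL_def by (rule Bochner_Integration.integral_cong) (simp_all add: F'g U_def lincomb_axis)
  have "?D = (\<lambda>c. fst c * EL a b L \<zeta> y v + (\<Sum>i\<in>UNIV. snd c $ i * EL a b L \<zeta> y (w i)))"
  proof (rule ext)
    fix c :: "real \<times> (real^'m)"
    show "?D c = fst c * EL a b L \<zeta> y v + (\<Sum>i\<in>UNIV. snd c $ i * EL a b L \<zeta> y (w i))"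
      using linear_prod_vec_expand[OF has_derivative_linear[OF D], of "fst c" "snd c"]
      unfolding D10 Da prod.collapse real_scaleR_def .
  qed
  moreover have "(\<lambda>c. LINT t|?M. F t (x0 t + U t c)) = (\<lambda>c. \<zeta> \<bullet> J a b L (\<lambda>t. y t + lincomb (v t) (\<lambda>i. w i t) c))"
    using J_eq_integral[OF C1 b q0 W1q_lincomb(1)[where w=w, OF W q0] W1q_lincomb(2)[where w=w, OF W q0], where \<zeta>=\<zeta>]
    by (intro ext) (simp add: F_def x0_def U_def)
  ultimately show ?thesis using D by simp
qed

section \<open>Minimality and the set derivative\<close>

lemma matrix_inv_inverse:
  fixes A :: "real^'n^'n"
  assumes "det A \<noteq> 0"
  shows "A ** matrix_inv A = mat 1" "matrix_inv A ** A = mat 1"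
proof -
  obtain B where "A ** B = mat 1 \<and> B ** A = mat 1"
    using assms unfolding invertible_det_nz[symmetric] invertible_def by blast
  then have "A ** matrix_inv A = mat 1 \<and> matrix_inv A ** A = mat 1"
    unfolding matrix_inv_def by (rule someI)
  then show "A ** matrix_inv A = mat 1" "matrix_inv A ** A = mat 1" by auto
qed

lemma has_vector_derivative_slope_tendsto:
  fixes g :: "real \<Rightarrow> real"
  assumes "(g has_vector_derivative d) (at 0 within S)"
  shows "((\<lambda>s. (g s - g 0) / s) \<longlongrightarrow> d) (at 0 within S)"
  using assms unfolding has_real_derivative_iff_has_vector_derivative[symmetric] has_field_derivative_iff
  by simp

text \<open>The one-sided first order condition at a left endpoint. Positivity of \<delta> makes 0 a
  limit point; otherwise the filter would be trivial and the derivative arbitrary.\<close>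

lemma has_vector_derivative_within_nonneg:
  fixes g :: "real \<Rightarrow> real"
  assumes d: "(g has_vector_derivative d) (at 0 within {0..<\<delta>})" and \<delta>: "0 < \<delta>"
    and ge: "\<And>s. s \<in> {0..<\<delta>} \<Longrightarrow> g 0 \<le> g s"
  shows "0 \<le> d"
proof (rule tendsto_lowerbound[OF has_vector_derivative_slope_tendsto[OF d]])
  show "\<forall>\<^sub>F s in at 0 within {0..<\<delta>}. 0 \<le> (g s - g 0) / s"
    unfolding eventually_at_filter using ge by (intro always_eventually) auto
  have "0 islimpt {0..<\<delta>}"
    unfolding islimpt_approachable
  proof (intro allI impI)
    fix e :: real assume "e > 0"
    then show "\<exists>x'\<in>{0..<\<delta>}. x' \<noteq> 0 \<and> dist x' 0 < e"
      using \<delta> by (intro bexI[of _ "min e \<delta> / 2"]) (auto simp: min_def dist_norm)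
  qed
  then show "at 0 within {0..<\<delta>} \<noteq> bot" by (simp add: trivial_limit_within)
qed

text \<open>The multiplier is the transposed inverse of \<open>Wmat\<close> applied to the vector of
  the \<open>EL\<close> values of the w_i. Moving the matrix to the other side of the inner product,
  by swapping the sums, identifies the derivative along the curve with \<xi> v.\<close>

lemma xi_multiplier_eq:
  fixes G :: "real^'n \<Rightarrow> real^'m"
  assumes "h = (\<chi> i. LINT t|lebesgue_on {a..b}. gradG G i (y t) \<bullet> v t)"
  shows "EL a b L \<zeta> y v + (\<Sum>i\<in>UNIV. (- (matrix_inv (Wmat a b G y w) *v h)) $ i * EL a b L \<zeta> y (w i))
    = xi a b L G \<zeta> y (multiplier a b L G \<zeta> y w) v"
proof -
  let ?A = "matrix_inv (Wmat a b G y w)"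
  have "(\<Sum>i\<in>UNIV. (?A *v h) $ i * EL a b L \<zeta> y (w i)) = (\<Sum>i\<in>UNIV. \<Sum>j\<in>UNIV. ?A $ i $ j * h $ j * EL a b L \<zeta> y (w i))"
    by (simp add: matrix_vector_mult_def sum_distrib_right)
  also have "\<dots> = (\<Sum>j\<in>UNIV. \<Sum>i\<in>UNIV. ?A $ i $ j * h $ j * EL a b L \<zeta> y (w i))"
    by (rule sum.swap)
  also have "\<dots> = (\<Sum>j\<in>UNIV. multiplier a b L G \<zeta> y w $ j * h $ j)"
    by (simp add: multiplier_def sum_distrib_left sum_distrib_right mult_ac)
  finally show ?thesis
    by (simp add: xi_def assms sum_negf)
qed

theorem corollary5p5:
  fixes a b q K K1 K2 :: real
    and A B :: "real^'n"
    and C :: "(real^'d) set"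
    and L :: "real \<Rightarrow> real^'n \<Rightarrow> real^'n \<Rightarrow> real^'d"
    and G :: "real^'n \<Rightarrow> real^'m"
    and M :: "(real \<Rightarrow> real^'n) set"
    and \<zeta> :: "real^'d"
    and y\<^sub>\<zeta> :: "real \<Rightarrow> real^'n"
    and w :: "'m \<Rightarrow> real \<Rightarrow> real^'n"
  assumes "a < b" and "1 < q" and "1 < CARD('d)"
    and "C \<noteq> {}" "C \<noteq> UNIV" "closed C" "convex C" "cone C"
    and "C1_on ({a..b} \<times> UNIV \<times> UNIV) (\<lambda>(t, y, p). L t y p)"
    and "\<And>t y p i. t \<in> {a..b} \<Longrightarrow>
           \<bar>L t y p $ i\<bar> \<le> K1 * (norm y powr q + norm p powr q + 1)"
    and "\<And>t y p i. t \<in> {a..b} \<Longrightarrow>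
           norm (grad (\<lambda>p. L t y p $ i) p) \<le> K2 * (norm y powr (q - 1) + norm p powr (q - 1) + 1)"
    and "\<And>t y p i. t \<in> {a..b} \<Longrightarrow>
           norm (grad (\<lambda>y. L t y p $ i) y) \<le> K2 * (norm y powr (q - 1) + norm p powr (q - 1) + 1)"
    and "\<And>x. G differentiable (at x)"
    and "\<And>x i. norm (gradG G i x) \<le> K * (norm x powr (q - 1) + 1)"
    and "infimizer (Jbar a b (X2 a b q A B G) C L) (X2 a b q A B G) M"
    and "\<zeta> \<in> dual_cone C - {0}"
    and "y\<^sub>\<zeta> \<in> M"
    and "scalarization \<zeta> (inf_translation (Jbar a b (X2 a b q A B G) C L) M) (\<lambda>t. 0) =
           ereal (\<zeta> \<bullet> J a b L y\<^sub>\<zeta>)"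
    and "\<And>i. w i \<in> W1q0 a b q"
    and "det (Wmat a b G y\<^sub>\<zeta> w) \<noteq> 0"
  shows "\<forall>v \<in> W1q0 a b q.
      (\<exists>\<delta> \<sigma>. implicit_curve a b G y\<^sub>\<zeta> w v \<delta> \<sigma>) \<and>
      (\<forall>\<delta> \<sigma>. implicit_curve a b G y\<^sub>\<zeta> w v \<delta> \<sigma> \<longrightarrow>
         has_set_deriv_along \<zeta>
           (inf_translation (Jbar a b (X2 a b q A B G) C L) M)
           (curve w v \<sigma>)
           (S_set (xi a b L G \<zeta> y\<^sub>\<zeta> (multiplier a b L G \<zeta> y\<^sub>\<zeta> w)) \<zeta> v)
           0 {0..<\<delta>} \<and>
         S_set (xi a b L G \<zeta> y\<^sub>\<zeta> (multiplier a b L G \<zeta> y\<^sub>\<zeta> w)) \<zeta> v = Hplus \<zeta>)"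
proof
  note q = \<open>1 < q\<close> and C1 = assms(9) and bL = assms(10) and bp = assms(11) and byL = assms(12)
    and dG = assms(13) and bG = assms(14) and inf = assms(15) and scal = assms(18)
  let ?X = "X2 a b q A B G" and ?y = "y\<^sub>\<zeta>" and ?W = "Wmat a b G y\<^sub>\<zeta> w"
  let ?f = "inf_translation (Jbar a b ?X C L) M"
  let ?\<xi> = "xi a b L G \<zeta> ?y (multiplier a b L G \<zeta> ?y w)"
  have q0: "0 \<le> q" using q by simp
  have yX: "?y \<in> ?X" using inf \<open>?y \<in> M\<close> by (auto simp: infimizer_def)
  have \<zeta>0: "\<zeta> \<noteq> 0" and \<zeta>C: "\<And>c. c \<in> C \<Longrightarrow> 0 \<le> \<zeta> \<bullet> c"
    using \<open>\<zeta> \<in> dual_cone C - {0}\<close> by (auto simp: dual_cone_def)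
  have C0: "0 \<in> C" using \<open>C \<noteq> {}\<close> \<open>cone C\<close> by (simp add: cone_contains_0)
  have Jmem: "J a b L y \<in> Jbar a b ?X C L y" if "y \<in> ?X" for y
    unfolding Jbar_def if_P[OF that] using C0 by (intro CollectI exI[of _ 0]) simp
  have Jmem_inf: "J a b L y \<in> lattice_inf (Jbar a b ?X C L ` ?X)" if "y \<in> ?X" for y
  proof -
    have "J a b L y \<in> \<Union> (Jbar a b ?X C L ` ?X)" using Jmem[OF that] that by (rule UN_I[rotated])
    then show ?thesis unfolding lattice_inf_def by (rule subsetD[OF closure_subset])
  qed
  have f0: "?f (\<lambda>t. 0) = lattice_inf (Jbar a b ?X C L ` ?X)"
    using inf by (simp add: inf_translation_def infimizer_def)
  have min: "\<zeta> \<bullet> J a b L ?y \<le> \<zeta> \<bullet> J a b L y" if "y \<in> ?X" for y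
  proof -
    have "J a b L y \<in> ?f (\<lambda>t. 0)"
      unfolding f0 by (rule Jmem_inf[OF that])
    then have "ereal (\<zeta> \<bullet> J a b L ?y) \<le> ereal (\<zeta> \<bullet> J a b L y)"
      unfolding scal[symmetric] scalarization_def by (rule INF_lower)
    then show ?thesis by simp
  qed
  \<comment> \<open>The bound holds for every translation \<open>u\<close>: infeasible translates
    contribute the empty set, feasible ones obey minimality, and adding elements of C can only raise
    the \<zeta>-value.\<close>
  have fbound: "\<zeta> \<bullet> J a b L ?y \<le> \<zeta> \<bullet> z" if "z \<in> ?f u" for z u
  proof -
    have "Jbar a b ?X C L y \<subseteq> {z. \<zeta> \<bullet> J a b L ?y \<le> \<zeta> \<bullet> z}" for y
    proof (cases "y \<in> ?X")
      case True
      show ?thesis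
        unfolding Jbar_def if_P[OF True]
        using min[OF True] by (auto simp: inner_add_right dest!: \<zeta>C)
    qed (simp add: Jbar_def)
    then have "\<Union> ((\<lambda>y. Jbar a b ?X C L (\<lambda>t. y t + u t)) ` M) \<subseteq> {z. \<zeta> \<bullet> J a b L ?y \<le> \<zeta> \<bullet> z}"
      by (rule UN_least)
    moreover have "closed {z. \<zeta> \<bullet> J a b L ?y \<le> \<zeta> \<bullet> z}"
      using closed_halfspace_ge[of "\<zeta> \<bullet> J a b L ?y" \<zeta>] by simp
    ultimately have "?f u \<subseteq> {z. \<zeta> \<bullet> J a b L ?y \<le> \<zeta> \<bullet> z}"
      unfolding inf_translation_def lattice_inf_def by (rule closure_minimal)
    then show ?thesis using that by blast
  qed
  fix v :: "real \<Rightarrow> real^'n" assume v: "v \<in> W1q0 a b q"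
  have W1q: "?y \<in> W1q a b q" "v \<in> W1q a b q" "\<And>i. w i \<in> W1q a b q"
    using yX v assms(19) by (auto simp: X2_def W1q0_def)
  have cont: "continuous_on {a..b} ?y" "continuous_on {a..b} v" "\<And>i. continuous_on {a..b} (w i)"
    using W1q by (auto simp: W1q_def)
  define h where "h = (\<chi> i. LINT t|lebesgue_on {a..b}. gradG G i (?y t) \<bullet> v t)"
  define p where "p = - (matrix_inv ?W *v h)"
  define Y where "Y c = (\<lambda>t. ?y t + lincomb (v t) (\<lambda>i. w i t) c)" for c
  let ?H = "\<lambda>c. hfun a b G ?y w v (fst c) (snd c)"
  note dH = hfun_has_derivative[where w=w, OF q dG bG cont, folded h_def]
  note cH = hfun_continuous[where w=w, OF q dG bG cont]
  have dJ: "((\<lambda>c. \<zeta> \<bullet> J a b L (Y c)) has_derivative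
      (\<lambda>c. fst c * EL a b L \<zeta> ?y v + (\<Sum>i\<in>UNIV. snd c $ i * EL a b L \<zeta> ?y (w i)))) (at 0)"
    unfolding Y_def by (rule J_has_derivative[where w=w, OF q C1 bL bp byL W1q])
  have Y0: "Y 0 = ?y" by (simp add: Y_def lincomb_def)
  have YX: "Y c \<in> ?X" if "?H c = 0" for c
  proof -
    have "Y c \<in> W1q a b q" unfolding Y_def by (rule W1q_lincomb(1)[where w=w, OF W1q q0])
    moreover have "Y c a = A" "Y c b = B"
      using yX v assms(19) by (auto simp: Y_def X2_def W1q0_def lincomb_def)
    moreover have "(LINT t|lebesgue_on {a..b}. G (Y c t)) = 0"
      using that by (simp add: Y_def hfun_def lincomb_def add.assoc)
    ultimately show ?thesis by (simp add: X2_def)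
  qed
  have H0: "?H 0 = 0"
    using yX by (simp add: hfun_def X2_def)
  have inv: "matrix_inv ?W *v (?W *v x) = x" for x
    by (simp add: matrix_vector_mul_assoc matrix_inv_inverse[OF assms(20)])
  have inj: "x = 0" if "matrix_inv ?W *v x = 0" for x
  proof -
    have "?W *v (matrix_inv ?W *v x) = x"
      by (simp add: matrix_vector_mul_assoc matrix_inv_inverse[OF assms(20)])
    then show ?thesis using that by simp
  qed
  have hs: "vector_derivative (\<lambda>s. hfun a b G ?y w v s 0) (at 0) = h"
  proof (rule vector_derivative_at)
    have "((\<lambda>s::real. (s, 0::real^'m)) has_derivative (\<lambda>s. (s, 0))) (at 0)"
      by (auto intro!: derivative_eq_intros)
    from has_derivative_compose[OF this, of ?H, OF dH[unfolded zero_prod_def]]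
    show "((\<lambda>s. hfun a b G ?y w v s 0) has_vector_derivative h) (at 0)"
      by (simp add: has_vector_derivative_def)
  qed
  text \<open>Both branches, \<open>\<tau> = 1\<close> and \<open>\<tau> = -1\<close>, are needed: minimality along them gives the two
    inequalities for \<open>\<xi> v\<close>.\<close>
  have ex: "\<exists>\<delta> \<sigma>. 0 < \<delta> \<and> \<sigma> 0 = 0 \<and> (\<forall>s\<in>{0..<\<delta>}. ?H (\<tau> * s, \<sigma> s) = 0) \<and>
      (\<sigma> has_vector_derivative \<tau> *\<^sub>R p) (at 0 within {0..<\<delta>})" for \<tau>
  proof -
    \<comment> \<open>Rescaling the first parameter by \<tau> lets the one-sided existence lemma
      cover both directions; the derivative of \<sigma> at 0 is scaled by \<tau>
      accordingly.\<close>
    let ?L = "\<lambda>c::real \<times> (real^'m). (\<tau> * fst c, snd c)"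
    have dL: "(?L has_derivative ?L) (at 0)"
      by (auto intro!: derivative_eq_intros)
    have dHL: "((\<lambda>c. ?H (?L c)) has_derivative (\<lambda>c. (\<tau> * fst c) *\<^sub>R h + ?W *v snd c)) (at 0)"
      using has_derivative_compose[OF dL, of ?H "\<lambda>c. fst c *\<^sub>R h + ?W *v snd c"] dH
      by (simp add: zero_prod_def)
    have cHL: "continuous_on UNIV (\<lambda>x. ?H (?L (s, x)))" for s
      by (rule continuous_on_compose2[OF cH]) (auto intro!: continuous_intros)
    obtain \<delta> \<sigma> where *: "0 < \<delta>" "\<sigma> 0 = 0" "\<And>s. s \<in> {0..<\<delta>} \<Longrightarrow> ?H (?L (s, \<sigma> s)) = 0"
      "(\<sigma> has_vector_derivative - (matrix_inv ?W *v ((\<tau> * fst (1::real, 0::real^'m)) *\<^sub>R h + ?W *v snd (1::real, 0::real^'m))))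
         (at 0 within {0..<\<delta>})"
    proof (rule implicit_curve_Brouwer[of "\<lambda>c. ?H (?L c)" "\<lambda>c. (\<tau> * fst c) *\<^sub>R h + ?W *v snd c" "(*v) (matrix_inv ?W)"])
      show "?H (?L 0) = 0" using H0 by (simp add: zero_prod_def)
    qed (use cHL dHL inv inj in simp_all)
    have "- (matrix_inv ?W *v ((\<tau> * fst (1::real, 0::real^'m)) *\<^sub>R h + ?W *v snd (1::real, 0::real^'m))) = \<tau> *\<^sub>R p"
      by (simp add: p_def matrix_vector_mult_scaleR)
    with * show ?thesis by (intro exI[of _ \<delta>] exI[of _ \<sigma>]) auto
  qed
  have dJc: "((\<lambda>s. \<zeta> \<bullet> J a b L (Y (\<tau> * s, \<sigma> s))) has_vector_derivative \<tau> * ?\<xi> v) (at 0 within S)"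
    if \<sigma>: "\<sigma> 0 = 0" "(\<sigma> has_vector_derivative \<tau> *\<^sub>R p) (at 0 within S)" for \<tau> \<sigma> S
  proof -
    have "((\<lambda>s. (\<tau> * s, \<sigma> s)) has_derivative (\<lambda>s. (\<tau> * s, s *\<^sub>R (\<tau> *\<^sub>R p)))) (at 0 within S)"
      using \<sigma>(2) unfolding has_vector_derivative_def by (intro has_derivative_Pair) (auto intro!: derivative_eq_intros)
    from has_derivative_compose[OF this, of "\<lambda>c. \<zeta> \<bullet> J a b L (Y c)"
        "\<lambda>c. fst c * EL a b L \<zeta> ?y v + (\<Sum>i\<in>UNIV. snd c $ i * EL a b L \<zeta> ?y (w i))"] dJ \<sigma>(1)
    have "((\<lambda>s. \<zeta> \<bullet> J a b L (Y (\<tau> * s, \<sigma> s))) has_derivative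
       (\<lambda>s. (\<tau> * s) * EL a b L \<zeta> ?y v + (\<Sum>i\<in>UNIV. (s *\<^sub>R \<tau> *\<^sub>R p) $ i * EL a b L \<zeta> ?y (w i)))) (at 0 within S)"
      by (simp add: zero_prod_def)
    moreover have "(\<tau> * s) * EL a b L \<zeta> ?y v + (\<Sum>i\<in>UNIV. (s *\<^sub>R \<tau> *\<^sub>R p) $ i * EL a b L \<zeta> ?y (w i)) = s *\<^sub>R (\<tau> * ?\<xi> v)" for s
      unfolding xi_multiplier_eq[OF h_def, symmetric] p_def
      by (simp add: algebra_simps sum_distrib_left sum_negf)
    ultimately show ?thesis by (simp add: has_vector_derivative_def)
  qed
  have sgn: "0 \<le> \<tau> * ?\<xi> v" for \<tau>
  proof -
    obtain \<delta> \<sigma> where *: "0 < \<delta>" "\<sigma> 0 = 0" "\<And>s. s \<in> {0..<\<delta>} \<Longrightarrow> ?H (\<tau> * s, \<sigma> s) = 0"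
      "(\<sigma> has_vector_derivative \<tau> *\<^sub>R p) (at 0 within {0..<\<delta>})"
      using ex by blast
    show ?thesis
    proof (rule has_vector_derivative_within_nonneg[OF dJc[OF *(2,4)] *(1)])
      fix s assume "s \<in> {0..<\<delta>}"
      from min[OF YX[OF *(3)[OF this]]]
      show "\<zeta> \<bullet> J a b L (Y (\<tau> * 0, \<sigma> 0)) \<le> \<zeta> \<bullet> J a b L (Y (\<tau> * s, \<sigma> s))"
        using Y0 *(2) by (simp add: zero_prod_def)
    qed
  qed
  have \<xi>0: "?\<xi> v = 0" using sgn[of 1] sgn[of "- 1"] by simp
  then have S: "S_set ?\<xi> \<zeta> v = Hplus \<zeta>" by (simp add: S_set_def Hplus_def)
  have "\<exists>\<delta> \<sigma>. implicit_curve a b G ?y w v \<delta> \<sigma>"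
    using ex[of 1] unfolding implicit_curve_def hs p_def by simp
  \<comment> \<open>Any admissible curve is treated here, not just a constructed one: its
    feasibility supplies the competitor \<open>Y (s, \<sigma> s)\<close>, and its prescribed
    derivative at 0 makes the objective's slope tend to \<xi> v = 0.\<close>
  moreover have "has_set_deriv_along \<zeta> ?f (curve w v \<sigma>) (Hplus \<zeta>) 0 {0..<\<delta>}"
    if \<sigma>: "implicit_curve a b G ?y w v \<delta> \<sigma>" for \<delta> \<sigma>
  proof (rule has_set_deriv_along_Hplus[OF \<zeta>0, where base = "J a b L ?y" and e = "\<lambda>s. J a b L (Y (s, \<sigma> s))"])
    have \<sigma>': "\<sigma> 0 = 0" "\<And>s. s \<in> {0..<\<delta>} \<Longrightarrow> ?H (s, \<sigma> s) = 0" "(\<sigma> has_vector_derivative p) (at 0 within {0..<\<delta>})"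
      using \<sigma> unfolding implicit_curve_def hs p_def by simp_all
    have c0: "curve w v \<sigma> 0 = (\<lambda>t. 0)" by (simp add: curve_def \<sigma>'(1))
    show "J a b L ?y \<in> ?f (curve w v \<sigma> 0)"
      unfolding c0 f0 by (rule Jmem_inf[OF yX])
    show "\<zeta> \<bullet> J a b L ?y \<le> \<zeta> \<bullet> z" if "z \<in> ?f (curve w v \<sigma> 0)" for z
      using that by (rule fbound)
    show "\<zeta> \<bullet> J a b L ?y \<le> \<zeta> \<bullet> z" if "z \<in> ?f (curve w v \<sigma> s)" for s z
      using that by (rule fbound)
    show "J a b L (Y (s, \<sigma> s)) \<in> ?f (curve w v \<sigma> s)" if "s \<in> {0..<\<delta>}" for s
    proof -
      have eq: "(\<lambda>t. ?y t + curve w v \<sigma> s t) = Y (s, \<sigma> s)"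
        by (simp add: Y_def curve_def lincomb_def)
      have "J a b L (Y (s, \<sigma> s)) \<in> Jbar a b ?X C L (\<lambda>t. ?y t + curve w v \<sigma> s t)"
        unfolding eq by (rule Jmem[OF YX[OF \<sigma>'(2)[OF that]]])
      then show ?thesis
        unfolding inf_translation_def lattice_inf_def
        by (intro subsetD[OF closure_subset] UN_I[OF \<open>?y \<in> M\<close>])
    qed
    show "((\<lambda>s. (\<zeta> \<bullet> J a b L (Y (s, \<sigma> s)) - \<zeta> \<bullet> J a b L ?y) / s) \<longlongrightarrow> 0) (at 0 within {0..<\<delta>})"
      using has_vector_derivative_slope_tendsto[OF dJc[of \<sigma> 1]] \<sigma>'(1,3) \<xi>0 Y0
      by (simp add: zero_prod_def)
  qed
  ultimately show "(\<exists>\<delta> \<sigma>. implicit_curve a b G ?y w v \<delta> \<sigma>) \<and>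
      (\<forall>\<delta> \<sigma>. implicit_curve a b G ?y w v \<delta> \<sigma> \<longrightarrow>
         has_set_deriv_along \<zeta> ?f (curve w v \<sigma>) (S_set ?\<xi> \<zeta> v) 0 {0..<\<delta>} \<and> S_set ?\<xi> \<zeta> v = Hplus \<zeta>)"
    unfolding S by blast
qed

end
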